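(* Let $m\ge1$, $L=\{1,\dots,m\}$, and let $\mathbf{X}$ and $\mathbf{Y}$ be $m$-dimensional (real) random variables. Assume that the distribution function $F_{\mathbf{Y}}$ is differentiable. For $1\le j\le m$ let $$A_j=\sup_{\mathbf{y}\in\mathbb{R}^m}\frac{\partial F_{\mathbf{Y}}(\mathbf{y})}{\partial y_j},\qquad B_j=\sum_{k=1}^{j}\genfrac{\{}{\}}{0pt}{}{j}{k}\,k!,$$ where $\genfrac{\{}{\}}{0pt}{}{j}{k}$ denotes the Stirling number of the second kind, and let $$C_1=\sqrt[3]{\frac{32}{\pi\bigl(1-\bigl(\frac34\bigr)^{1/m}\bigr)}},\qquad C_2=\frac{12}{\pi}.$$ Let $T>0$ be fixed. Then $$\begin{aligned}\sup_{\mathbf{z}\in\mathbb{R}^m}\bigl|F_{\mathbf{X}}(\mathbf{z})-F_{\mathbf{Y}}(\mathbf{z})\bigr|\le{}&\frac{2}{(2\pi)^m}\int_{\|\mathbf{t}\|\le T}\left|\frac{\Lambda(\varphi_{\mathbf{X}})(\mathbf{t})-\Lambda(\varphi_{\mathbf{Y}})(\mathbf{t})}{\prod_{\ell\in L}t_\ell}\right|d\mathbf{t}\\&+2\sum_{\emptyset\ne J\subsetneq L}B_{m-|J|}\sup_{\mathbf{z}_J\in\mathbb{R}^J}\bigl|F_{\mathbf{X}_J}(\mathbf{z}_J)-F_{\mathbf{Y}_J}(\mathbf{z}_J)\bigr|\\&+\frac{2\sum_{j=1}^mA_j}{T}(C_1+C_2).\end{aligned}$$ Moreover, existence of $\mathbb{E}(\mathbf{X})$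 and $\mathbb{E}(\mathbf{Y})$ is sufficient for the finiteness of the integral in this inequality.
   Context: For a random variable $\mathbf{Z}$ with values in $\mathbb{R}^K$ ($K$ a finite index set), $F_{\mathbf{Z}}(\mathbf{z})=\mathbb{P}(\mathbf{Z}\le\mathbf{z})$ (componentwise inequality) is its cumulative distribution function and $\varphi_{\mathbf{Z}}(\mathbf{t})=\mathbb{E}(e^{i\langle\mathbf{t},\mathbf{Z}\rangle})$ its characteristic function. $\|\mathbf{t}\|=\max_j|t_j|$ is the maximum norm; the integral is over $\mathbf{t}\in\mathbb{R}^m$ with $\|\mathbf{t}\|\le T$. For $J\subseteq L$, $\mathbf{X}_J=(X_j)_{j\in J}$ is the projection to the coordinates in $J$, so $F_{\mathbf{X}_J}$ is a marginal distribution function. For $J\subseteq K\subseteq L$, let $\psi_{J,K}$ be the map $(s_k)_{k\in K}\mapsto(s_k[k\in J])_{k\in K}$ that sets all coordinates with index in $K\setminus J$ to $0$ (here $[k\in J]$ is $1$ if $k\in J$ and $0$ otherwise). Let $\Pi_K$ be the set of all set partitions of $K$; a partition $\alpha=\{J_1,\dots,J_k\}$ is a set of parts, with $|\alpha|$ the number of parts. For a complex-valued function $h$ on $\mathbb{C}^K$ (or on $\mathbb{R}^K$), define $$\Lambda_K(h)=\sum_{\alpha\in\Pi_K}\mu_\alpha\prod_{J\in\alpha}h\circ\psi_{J,K},\qquad\mu_\alpha=(-1)^{|\alpha|-1}(|\alpha|-1)!,$$ and write $\Lambda=\Lambda_L$. For example, for $m=2$, $\Lambda(h)(s_1,s_2)=h(s_1,s_2)-h(s_1,0)h(0,s_2)$.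 *)

theory Defs
  imports "HOL-Probability.Probability" "HOL-Combinatorics.Stirling"
begin

text \<open>Vectors with coordinates in a finite index set are elements of \<open>'a ^ 'k\<close>; the index set is
  \<open>UNIV :: 'k set\<close>, and the dimension is \<open>CARD('k)\<close>.\<close>

text \<open>The order is componentwise both on \<open>real ^ 'k\<close> and on \<open>'k \<Rightarrow> real\<close>. Points of the space of
  families indexed by \<open>J\<close> are the members of \<open>J \<rightarrow>\<^sub>E UNIV\<close>; these all agree outside \<open>J\<close>, so
  comparing two of them means comparing the coordinates in \<open>J\<close>.\<close>

definition joint_cdf :: "'a measure \<Rightarrow> ('a \<Rightarrow> 'b::order) \<Rightarrow> 'b \<Rightarrow> real" where
  "joint_cdf M Z z = measure M {\<omega> \<in> space M. Z \<omega> \<le> z}"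

definition proj :: "'k set \<Rightarrow> ('a \<Rightarrow> real ^ 'k) \<Rightarrow> 'a \<Rightarrow> 'k \<Rightarrow> real" where
  "proj J Z \<omega> = (\<lambda>j\<in>J. Z \<omega> $ j)"

definition char_fun :: "'a measure \<Rightarrow> ('a \<Rightarrow> real ^ 'k) \<Rightarrow> real ^ 'k \<Rightarrow> complex" where
  "char_fun M Z t = (\<integral>\<omega>. exp (\<i> * complex_of_real (t \<bullet> Z \<omega>)) \<partial>M)"

definition psi :: "'k set \<Rightarrow> 'a::zero ^ 'k \<Rightarrow> 'a ^ 'k" where
  "psi J s = (\<chi> k. if k \<in> J then s $ k else 0)"

definition mu :: "'k set set \<Rightarrow> complex" where
  "mu \<alpha> = (-1) ^ (card \<alpha> - 1) * fact (card \<alpha> - 1)"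

definition Lambda :: "('a::zero ^ 'k \<Rightarrow> complex) \<Rightarrow> 'a ^ 'k \<Rightarrow> complex" where
  "Lambda h s = (\<Sum>\<alpha> | partition_on (UNIV :: 'k set) \<alpha>. mu \<alpha> * (\<Prod>J\<in>\<alpha>. h (psi J s)))"

definition partial_deriv :: "'k \<Rightarrow> (real ^ 'k \<Rightarrow> real) \<Rightarrow> real ^ 'k \<Rightarrow> real" where
  "partial_deriv j F y = deriv (\<lambda>s. F (y + s *\<^sub>R axis j 1)) 0"

text \<open>The supremum may be infinite. A distribution function is monotone in each coordinate, so its
  partial derivatives are nonnegative and \<open>ennreal\<close> does not truncate them.\<close>

definition A_coeff :: "'a measure \<Rightarrow> ('a \<Rightarrow> real ^ 'k) \<Rightarrow> 'k \<Rightarrow> ennreal" where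
  "A_coeff N Y j = (SUP y. ennreal (partial_deriv j (joint_cdf N Y) y))"

definition B_coeff :: "nat \<Rightarrow> nat" where
  "B_coeff j = (\<Sum>k=1..j. Stirling j k * fact k)"

definition C1 :: "nat \<Rightarrow> real" where
  "C1 m = root 3 (32 / (pi * (1 - (3/4) powr (1 / real m))))"

definition C2 :: real where
  "C2 = 12 / pi"

text \<open>\<open>infnorm\<close> is the maximum norm on \<open>real ^ 'k\<close>. The integrand is undefined only on the null set
  where some coordinate vanishes. The integral may be infinite.\<close>

definition Lambda_integral ::
  "'a measure \<Rightarrow> ('a \<Rightarrow> real ^ 'k) \<Rightarrow> 'b measure \<Rightarrow> ('b \<Rightarrow> real ^ 'k) \<Rightarrow> real \<Rightarrow> ennreal" where
  "Lambda_integral M X N Y T =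
     (\<integral>\<^sup>+ t \<in> {t. infnorm t \<le> T}.
        ennreal (cmod ((Lambda (char_fun M X) t - Lambda (char_fun N Y) t)
                       / complex_of_real (\<Prod>l\<in>UNIV. t $ l))) \<partial>lborel)"

end

theory Submission
  imports Defs "HOL-Real_Asymp.Real_Asymp"
begin

text \<open>
  The proof follows Sadikova's approach to multidimensional Berry--Esseen bounds. Put
  \<open>D = F\<^sub>X - F\<^sub>Y\<close> and let \<open>Q\<close> have independent coordinates whose common density \<open>p\<close> is a
  multiple of \<open>(sin (x / 4) / x) ^ 4\<close>, so that its characteristic function vanishes outside
  \<open>[-1, 1]\<close>. The argument has three parts.

  \<^item> \<^emph>\<open>Smoothing.\<close> \<open>F\<^sub>X\<close> is monotone and \<open>F\<^sub>Y\<close> grows by at most \<open>A\<^sub>j h\<^sub>j\<close> when its \<open>j\<close>-th argument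
    grows by \<open>h\<^sub>j\<close>. Hence a large value of \<open>D\<close> at \<open>z\<^sub>0\<close> persists on the orthant above \<open>z\<^sub>0\<close>,
    and a very negative one on the orthant below. The constant \<open>C1\<close> is the shift for which
    \<open>z\<^sub>0 + C1 / T - Q / T\<close> lies in that orthant with probability at least \<open>3/4\<close>, and \<open>C2\<close> bounds
    the first absolute moment of a coordinate of \<open>Q\<close>. Averaging over \<open>Q\<close> bounds \<open>sup \<bar>D\<bar>\<close> by twice
    \<open>sup \<bar>E (D (z - Q / T))\<bar>\<close> plus the error term with the \<open>A\<^sub>j\<close>
    (\<open>smoothing_lower_bound\<close>).

  \<^item> \<^emph>\<open>Passing to \<open>\<Lambda>\<close>.\<close> For a partition \<open>\<alpha>\<close> of the coordinates the product \<open>\<Prod>J\<in>\<alpha>. \<phi> (\<psi>\<^sub>J t)\<close> is the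
    characteristic function of a vector assembled from independent copies of \<open>X\<close>, one for each
    block. So \<open>\<Lambda> (\<phi>\<^sub>X) - \<Lambda> (\<phi>\<^sub>Y)\<close> is the Fourier transform of a signed measure, whose distribution
    function differs from \<open>D\<close> only by products over partitions with at least two blocks. The difference of two
    such products is at most the sum of the differences of the marginal distribution
    functions; counting the partitions that contain a given block produces the numbers
    \<open>B_coeff\<close> (\<open>smoothed_difference_bound\<close>).

  \<^item> \<^emph>\<open>Inversion.\<close> The smoothed distribution function of the signed measure has to be bounded by the
    integral of \<open>\<bar>\<Lambda> (\<phi>\<^sub>X) - \<Lambda> (\<phi>\<^sub>Y)\<bar> / \<Prod> \<bar>t\<^sub>l\<bar>\<close>. Formally it is an inverse Fourier integral with the factors
    \<open>1 / (- \<i> t\<^sub>l)\<close>. These are not integrable one by one, so every one-dimensional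
    distribution function is first damped by \<open>e ^ (- \<epsilon> (u - x))\<close>, which turns the factor into \<open>1 / (\<epsilon> - \<i> t)\<close>. Then
    Fubini's theorem applies, and since \<open>\<bar>\<epsilon> - \<i> t\<bar> \<ge> \<bar>t\<bar>\<close> the bound is uniform in \<open>\<epsilon>\<close>; only the
    left-hand side has to be followed to the limit \<open>\<epsilon> \<rightarrow> 0\<close>
    (\<open>damped_box_fourier\<close>, \<open>Lambda_smoothing_bound\<close>).

  For the finiteness of the integral, \<open>\<Lambda> (\<phi>\<^sub>X) - \<Lambda> (\<phi>\<^sub>Y)\<close> vanishes as soon as one coordinate of \<open>t\<close> is zero,
  because \<open>\<Lambda>\<close> is a kind of joint cumulant, and it is Lipschitz in each coordinate if the
  expectations exist. It is therefore at most \<open>C \<cdot> min \<bar>t\<^sub>l\<bar> \<le> C \<cdot> \<Prod> \<bar>t\<^sub>l\<bar> powr (1 / m)\<close>, and the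
  function \<open>\<Prod> \<bar>t\<^sub>l\<bar> powr (1 / m - 1)\<close> is integrable near the origin (\<open>Lambda_integral_finite\<close>).
\<close>

section \<open>Set partitions and the cumulant property\<close>

text \<open>A new point \<open>a\<close> either forms a block of its own or joins one of the existing blocks.\<close>

lemma sum_partitions_insert:
  fixes f :: "'k set set \<Rightarrow> 'b::comm_monoid_add"
  assumes "finite A" "a \<notin> A"
  shows "(\<Sum>\<alpha> | partition_on (insert a A) \<alpha>. f \<alpha>) =
    (\<Sum>\<beta> | partition_on A \<beta>. f (insert {a} \<beta>) + (\<Sum>J\<in>\<beta>. f (insert (insert a J) (\<beta> - {J}))))"
proof -
  \<comment> \<open>the block of \<open>a\<close>, written as a union so that it is defined without a choice\<close>
  define blk where "blk \<alpha> = \<Union>{K\<in>\<alpha>. a \<in> K}" for \<alpha> :: "'k set set"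
  have blk: "blk \<alpha> \<in> \<alpha>" "a \<in> blk \<alpha>" "\<And>K. K \<in> \<alpha> \<Longrightarrow> K \<noteq> blk \<alpha> \<Longrightarrow> K \<inter> blk \<alpha> = {}"
    if p: "partition_on (insert a A) \<alpha>" for \<alpha>
  proof -
    obtain K where K: "K \<in> \<alpha>" "a \<in> K"
      using partition_onD1[OF p] by blast
    have "K' = K" if "K' \<in> \<alpha>" "a \<in> K'" for K'
      using partition_onD2[OF p] K that by (meson disjnt_iff pairwiseD)
    then have "{K\<in>\<alpha>. a \<in> K} = {K}" using K by blast
    then have "blk \<alpha> = K" by (simp add: blk_def)
    then show "blk \<alpha> \<in> \<alpha>" "a \<in> blk \<alpha>" using K by simp_all
    show "L \<inter> blk \<alpha> = {}" if "L \<in> \<alpha>" "L \<noteq> blk \<alpha>" for L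
      using that K(1) partition_onD2[OF p] unfolding \<open>blk \<alpha> = K\<close> by (meson disjnt_def pairwiseD)
  qed
  have rejoin: "insert (insert a (blk \<alpha> - {a})) ((\<alpha> - {blk \<alpha>}) \<union> ({blk \<alpha> - {a}} - {{}}) - {blk \<alpha> - {a}}) = \<alpha>"
    if p: "partition_on (insert a A) \<alpha>" for \<alpha>
  proof -
    have "blk \<alpha> - {a} \<notin> \<alpha>"
    proof
      assume h: "blk \<alpha> - {a} \<in> \<alpha>"
      have "blk \<alpha> - {a} \<noteq> blk \<alpha>" using blk(2)[OF p] by blast
      then have "(blk \<alpha> - {a}) \<inter> blk \<alpha> = {}" using blk(3)[OF p h] by blast
      then have "blk \<alpha> - {a} = {}" by blast
      then show False using h partition_onD3[OF p] by metis
    qed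
    then have "(\<alpha> - {blk \<alpha>}) \<union> ({blk \<alpha> - {a}} - {{}}) - {blk \<alpha> - {a}} = \<alpha> - {blk \<alpha>}"
      by blast
    moreover have "insert a (blk \<alpha> - {a}) = blk \<alpha>" using blk(2)[OF p] by blast
    ultimately show ?thesis using blk(1)[OF p] by (simp add: insert_absorb)
  qed
  have notin: "a \<notin> J" if "partition_on A \<beta>" "J \<in> \<beta>" for \<beta> J
    using that assms partition_onD1 by blast
  have "(\<Sum>\<alpha> | partition_on (insert a A) \<alpha>. f \<alpha>) =
     (\<Sum>(\<beta>,J)\<in>(SIGMA \<beta>:{\<beta>. partition_on A \<beta>}. insert {} \<beta>). f (insert (insert a J) (\<beta> - {J})))"
  proof (rule sum.reindex_bij_witness[where
        i = "\<lambda>(\<beta>,J). insert (insert a J) (\<beta> - {J})" and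
        j = "\<lambda>\<alpha>. ((\<alpha> - {blk \<alpha>}) \<union> ({blk \<alpha> - {a}} - {{}}), blk \<alpha> - {a})"], goal_cases)
    case (1 \<alpha>)
    then show ?case using rejoin[of \<alpha>] by simp
  next
    case (2 \<alpha>)
    then have p: "partition_on (insert a A) \<alpha>" by simp
    let ?\<beta> = "(\<alpha> - {blk \<alpha>}) \<union> ({blk \<alpha> - {a}} - {{}})"
    have "partition_on A ?\<beta>"
    proof (rule partition_onI)
      have "\<Union>?\<beta> = \<Union>(\<alpha> - {blk \<alpha>}) \<union> (blk \<alpha> - {a})" by auto
      also have "\<dots> = \<Union>\<alpha> - {a}" using blk[OF p] by blast
      also have "\<dots> = A" using partition_onD1[OF p] assms by blast
      finally show "\<Union>?\<beta> = A" .
      show "{} \<notin> ?\<beta>" using partition_onD3[OF p] by simp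
      show "disjnt K K'" if KK: "K \<in> ?\<beta>" "K' \<in> ?\<beta>" "K \<noteq> K'" for K K'
      proof -
        have "disjnt K K'" if "K \<in> \<alpha>" "K' \<in> \<alpha>"
          using partition_onD2[OF p] that \<open>K \<noteq> K'\<close> by (auto simp: pairwise_def)
        moreover consider "K \<in> \<alpha>" "K' \<in> \<alpha>"
          | "K \<in> \<alpha>" "K \<noteq> blk \<alpha>" "K' = blk \<alpha> - {a}" | "K' \<in> \<alpha>" "K' \<noteq> blk \<alpha>" "K = blk \<alpha> - {a}"
          using KK by blast
        ultimately show ?thesis
          using blk(3)[OF p, of K] blk(3)[OF p, of K'] by cases (auto simp: disjnt_def)
      qed
    qed
    then show ?case by auto
  next
    case (3 x)
    then obtain \<beta> J where x: "x = (\<beta>, J)" and p: "partition_on A \<beta>" and J: "J \<in> insert {} \<beta>"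
      by auto
    let ?\<alpha> = "insert (insert a J) (\<beta> - {J})"
    have nb: "a \<notin> K" if "K \<in> \<beta>" for K using notin[OF p that] .
    have nJ: "a \<notin> J" using J nb by auto
    have "{K \<in> ?\<alpha>. a \<in> K} = {insert a J}" using nb by auto
    then have b: "blk ?\<alpha> = insert a J" by (simp add: blk_def)
    have "insert a J \<notin> \<beta>" using nb by auto
    then have "?\<alpha> - {insert a J} = \<beta> - {J}" by auto
    then show ?case using nJ J partition_onD3[OF p] by (auto simp: x b)
  next
    case (4 x)
    then obtain \<beta> J where x: "x = (\<beta>, J)" and p: "partition_on A \<beta>" and J: "J \<in> insert {} \<beta>"
      by auto
    have nb: "a \<notin> K" if "K \<in> \<beta>" for K using notin[OF p that] .
    have un: "\<Union>\<beta> = A" using partition_onD1[OF p] by simp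
    have dj: "disjnt K K'" if "K \<in> \<beta>" "K' \<in> insert J \<beta>" "K \<noteq> K'" for K K'
      using partition_onD2[OF p] that J by (auto simp: pairwise_def)
    have "partition_on (insert a A) (insert (insert a J) (\<beta> - {J}))"
    proof (rule partition_onI)
      have "\<Union>(insert (insert a J) (\<beta> - {J})) = insert a (J \<union> \<Union>\<beta>)" by blast
      also have "\<dots> = insert a A" using un J by auto
      finally show "\<Union>(insert (insert a J) (\<beta> - {J})) = insert a A" .
      show "{} \<notin> insert (insert a J) (\<beta> - {J})" using partition_onD3[OF p] by auto
      show "disjnt K K'" if "K \<in> insert (insert a J) (\<beta> - {J})" 
        "K' \<in> insert (insert a J) (\<beta> - {J})" "K \<noteq> K'" for K K'
        using that dj[of K K'] dj[of K J] dj[of K' J] nb by (auto simp: disjnt_def)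
    qed
    then show ?case by (simp add: x)
  next
    case (5 \<alpha>)
    then show ?case using rejoin[of \<alpha>] by simp
  qed
  also have "\<dots> = (\<Sum>\<beta> | partition_on A \<beta>. \<Sum>J\<in>insert {} \<beta>. f (insert (insert a J) (\<beta> - {J})))"
    by (rule sum.Sigma[symmetric])
      (use assms finitely_many_partition_on finite_elements in \<open>auto\<close>)
  also have "\<dots> = (\<Sum>\<beta> | partition_on A \<beta>. f (insert {a} \<beta>) + (\<Sum>J\<in>\<beta>. f (insert (insert a J) (\<beta> - {J}))))"
  proof (rule sum.cong[OF refl])
    fix \<beta> assume "\<beta> \<in> {\<beta>. partition_on A \<beta>}"
    then have "finite \<beta>" "{} \<notin> \<beta>" using assms finite_elements partition_onD3 by auto
    then show "(\<Sum>J\<in>insert {} \<beta>. f (insert (insert a J) (\<beta> - {J}))) =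
      f (insert {a} \<beta>) + (\<Sum>J\<in>\<beta>. f (insert (insert a J) (\<beta> - {J})))"
      by simp
  qed
  finally show ?thesis .
qed

lemma card_insert_block:
  assumes "finite A" "a \<notin> A" "partition_on A \<beta>"
  shows "card (insert {a} \<beta>) = Suc (card \<beta>)"
    and "J \<in> \<beta> \<Longrightarrow> card (insert (insert a J) (\<beta> - {J})) = card \<beta>"
proof -
  have fin: "finite \<beta>" using assms finite_elements by auto
  have nb: "a \<notin> K" if "K \<in> \<beta>" for K using that assms partition_onD1 by blast
  show "card (insert {a} \<beta>) = Suc (card \<beta>)" using fin nb by (subst card_insert_disjoint) auto
  assume J: "J \<in> \<beta>"
  have "insert a J \<notin> \<beta> - {J}" using nb by auto
  then show "card (insert (insert a J) (\<beta> - {J})) = card \<beta>"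
    using fin card_Suc_Diff1[OF fin J] by simp
qed

text \<open>The recursion of the Stirling numbers is the recursion of the previous lemma for weights that
  depend on the number of blocks only.\<close>

lemma sum_partitions_card:
  fixes w :: "nat \<Rightarrow> nat"
  assumes "finite A"
  shows "(\<Sum>\<alpha> | partition_on A \<alpha>. w (card \<alpha>)) = (\<Sum>k\<le>card A. Stirling (card A) k * w k)"
  using assms
proof (induction A arbitrary: w rule: finite_induct)
  case empty
  then show ?case by (simp add: partition_on_empty)
next
  case (insert a A)
  let ?n = "card A"
  have "(\<Sum>\<alpha> | partition_on (insert a A) \<alpha>. w (card \<alpha>)) =
      (\<Sum>\<beta> | partition_on A \<beta>. w (Suc (card \<beta>)) + card \<beta> * w (card \<beta>))"
    unfolding sum_partitions_insert[OF insert(1,2)]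
    by (intro sum.cong refl) (simp add: card_insert_block[OF insert(1,2)])
  also have "\<dots> = (\<Sum>k\<le>?n. Stirling ?n k * (w (Suc k) + k * w k))"
    by (rule insert.IH)
  also have "\<dots> = (\<Sum>k\<le>?n. Stirling ?n k * w (Suc k)) + (\<Sum>k\<le>Suc ?n. k * Stirling ?n k * w k)"
    by (simp add: sum.distrib[symmetric] algebra_simps)
  also have "\<dots> = (\<Sum>k\<le>?n. Stirling ?n k * w (Suc k)) + (\<Sum>k\<le>?n. Suc k * Stirling ?n (Suc k) * w (Suc k))"
    by (simp only: sum.atMost_Suc_shift)
  also have "\<dots> = (\<Sum>k\<le>?n. Stirling (Suc ?n) (Suc k) * w (Suc k))"
    by (simp add: sum.distrib[symmetric] algebra_simps)
  also have "\<dots> = (\<Sum>k\<le>Suc ?n. Stirling (Suc ?n) k * w k)"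
    by (subst sum.atMost_Suc_shift) simp
  finally show ?case using insert by simp
qed

lemma sum_partitions_fact_card:
  assumes "finite A" "A \<noteq> {}"
  shows "(\<Sum>\<alpha> | partition_on A \<alpha>. fact (card \<alpha>)) = B_coeff (card A)"
proof -
  have "card A > 0" using assms by (simp add: card_gt_0_iff)
  then have z: "Stirling (card A) 0 = 0" by (cases "card A") auto
  have "{..card A} = insert 0 {1..card A}" by auto
  then show ?thesis
    unfolding B_coeff_def sum_partitions_card[OF assms(1), of fact] by (simp add: z)
qed

text \<open>Removing the block \<open>J\<close> leaves an arbitrary partition of the complement of \<open>J\<close>, with one
  block fewer. This is the weight that the marginal of \<open>J\<close> receives in the
  main inequality.\<close>

lemma sum_partitions_containing:
  fixes J :: "'k::finite set"
  assumes "J \<noteq> {}" "J \<noteq> UNIV"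
  shows "(\<Sum>\<alpha> | partition_on UNIV \<alpha> \<and> J \<in> \<alpha>. fact (card \<alpha> - 1)) = B_coeff (CARD('k) - card J)"
proof -
  have nin: "J \<notin> \<beta>" if "partition_on (- J) \<beta>" for \<beta>
    using partition_onD1[OF that] assms by blast
  have iff: "partition_on UNIV (insert J \<beta>) \<longleftrightarrow> partition_on (- J) \<beta>" if "J \<notin> \<beta>" for \<beta>
  proof -
    have "\<Union>\<beta> \<inter> J = {}" if "partition_on UNIV (insert J \<beta>)"
      using partition_onD2[OF that] \<open>J \<notin> \<beta>\<close> by (auto simp: pairwise_def disjnt_def)
    moreover have "\<Union>\<beta> \<inter> J = {}" if "partition_on (-J) \<beta>"
      using partition_onD1[OF that] by auto
    ultimately show ?thesis
      using partition_on_insert[of J \<beta> UNIV] assms(1)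
      by (auto simp: disjnt_def Compl_eq_Diff_UNIV)
  qed
  have "(\<Sum>\<alpha> | partition_on UNIV \<alpha> \<and> J \<in> \<alpha>. fact (card \<alpha> - 1)) =
      (\<Sum>\<beta> | partition_on (- J) \<beta>. fact (card \<beta>) :: nat)"
  proof (rule sum.reindex_bij_witness[where i = "insert J" and j = "\<lambda>\<alpha>. \<alpha> - {J}"], goal_cases)
    case (2 \<alpha>)
    then show ?case using iff[of "\<alpha> - {J}"] by (simp add: insert_absorb)
  next
    case (5 \<alpha>)
    then show ?case by (simp add: card_Diff_singleton)
  qed (use nin iff in auto)
  also have "\<dots> = B_coeff (card (- J))"
    using assms by (intro sum_partitions_fact_card) auto
  also have "card (- J) = CARD('k) - card J" by (simp add: Compl_eq_Diff_UNIV card_Diff_subset)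
  finally show ?thesis .
qed

text \<open>The cumulant property. Fix a partition \<open>\<beta>\<close> of the other coordinates with \<open>k\<close> blocks. As the
  coordinate \<open>l\<close> of \<open>s\<close> is zero, adding \<open>l\<close> as a new block or to any of the \<open>k\<close> blocks gives the same product,
  and the coefficients cancel: \<open>(-1) ^ k k! + k (-1) ^ (k - 1) (k - 1)! = 0\<close>. The bound on the
  dimension ensures \<open>k \<ge> 1\<close>.\<close>

lemma Lambda_eq_0:
  fixes h :: "'a::zero ^ 'k \<Rightarrow> complex"
  assumes h0: "h 0 = 1" and l: "s $ l = 0" and card: "CARD('k) \<ge> 2"
  shows "Lambda h s = 0"
proof -
  let ?A = "UNIV - {l}"
  let ?g = "\<lambda>\<alpha>. mu \<alpha> * (\<Prod>J\<in>\<alpha>. h (psi J s))"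
  have U: "insert l ?A = UNIV" by auto
  have "Lambda h s = (\<Sum>\<beta> | partition_on ?A \<beta>. ?g (insert {l} \<beta>)
      + (\<Sum>J\<in>\<beta>. ?g (insert (insert l J) (\<beta> - {J}))))"
    using sum_partitions_insert[of ?A l ?g] by (simp add: U Lambda_def)
  also have "\<dots> = 0"
  proof (rule sum.neutral, safe)
    fix \<beta> assume p: "partition_on ?A \<beta>"
    have fin: "finite \<beta>" by simp
    have nb: "l \<notin> K" if "K \<in> \<beta>" for K using that p partition_onD1 by blast
    have "?A \<noteq> {}"
    proof
      assume "?A = {}"
      then have "(UNIV :: 'k set) = {l}" by auto
      then have "CARD('k) = card {l}" by (rule arg_cong)
      then show False using card by simp
    qed
    then have "\<beta> \<noteq> {}" using partition_onD1[OF p] by auto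
    then obtain k where k: "card \<beta> = Suc k" using fin by (metis card_eq_0_iff not0_implies_Suc)
    have cards: "card (insert {l} \<beta>) = Suc (Suc k)"
      "\<And>J. J \<in> \<beta> \<Longrightarrow> card (insert (insert l J) (\<beta> - {J})) = Suc k"
      using card_insert_block[of ?A l \<beta>] p k by auto
    have psi_l: "psi {l} s = 0" using l by (simp add: psi_def vec_eq_iff)
    have psi_ins: "psi (insert l J) s = psi J s" for J using l by (auto simp: psi_def vec_eq_iff)
    have "?g (insert {l} \<beta>) = mu (insert {l} \<beta>) * (\<Prod>J\<in>\<beta>. h (psi J s))"
      using nb by (subst prod.insert) (auto simp: psi_l h0)
    moreover have "?g (insert (insert l J) (\<beta> - {J})) =
        mu (insert (insert l J) (\<beta> - {J})) * (\<Prod>J\<in>\<beta>. h (psi J s))" if "J \<in> \<beta>" for J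
      using nb prod.remove[OF fin that, of "\<lambda>J. h (psi J s)"] by (subst prod.insert) (auto simp: psi_ins)
    ultimately show "?g (insert {l} \<beta>) + (\<Sum>J\<in>\<beta>. ?g (insert (insert l J) (\<beta> - {J}))) = 0"
      by (simp add: mu_def cards k algebra_simps)
  qed
  finally show ?thesis .
qed

section \<open>The smoothing kernel and its Fourier transform\<close>

text \<open>The Parzen window, that is the fourfold convolution of the uniform density on \<open>[-1/4, 1/4]\<close>,
  normalised to be \<open>1\<close> at the origin. Written with truncated powers, its Fourier transform follows
  from that of the single function \<open>max 0 (b - \<bar>t\<bar>) ^ 3\<close>.\<close>

definition parzen :: "real \<Rightarrow> real" where
  "parzen t = 2 * max 0 (1 - \<bar>t\<bar>) ^ 3 - 8 * max 0 (1/2 - \<bar>t\<bar>) ^ 3"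

text \<open>The Jackson--de la Vallee-Poussin kernel. Division by zero makes it \<open>0\<close> instead of \<open>3 / (8 \<pi>)\<close> at
  the origin, which changes it on a null set only.\<close>

definition jackson :: "real \<Rightarrow> real" where
  "jackson x = 96 / pi * sin (x / 4) ^ 4 / x ^ 4"

lemma cubic_hat_fourier:
  fixes b x :: real
  assumes "b > 0" "x \<noteq> 0"
  shows "has_bochner_integral lborel
    (\<lambda>t. complex_of_real (max 0 (b - \<bar>t\<bar>) ^ 3) * exp (- (\<i> * of_real (x * t))))
    (of_real (6 * b\<^sup>2 / x\<^sup>2 - 12 * (1 - cos (b * x)) / x ^ 4))"
proof -
  define c where "c = - (\<i> * complex_of_real x)"
  have c0: "c \<noteq> 0" using assms by (simp add: c_def)
  let ?E = "\<lambda>t::real. exp (c * of_real t)"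
  \<comment> \<open>antiderivatives on the two halves of the support, found by repeated integration by parts\<close>
  define F1 where "F1 t = ((of_real b + of_real t) ^ 3 / c - 3 * (of_real b + of_real t)\<^sup>2 / c\<^sup>2
      + 6 * (of_real b + of_real t) / c ^ 3 - 6 / c ^ 4) * ?E t" for t :: real
  define F2 where "F2 t = ((of_real b - of_real t) ^ 3 / c + 3 * (of_real b - of_real t)\<^sup>2 / c\<^sup>2
      + 6 * (of_real b - of_real t) / c ^ 3 + 6 / c ^ 4) * ?E t" for t :: real
  have d1: "(F1 has_vector_derivative (of_real b + of_real t) ^ 3 * ?E t) (at t within S)" for t S
  proof -
    have "((\<lambda>z. ((of_real b + z) ^ 3 / c - 3 * (of_real b + z)\<^sup>2 / c\<^sup>2
      + 6 * (of_real b + z) / c ^ 3 - 6 / c ^ 4) * exp (c * z)) has_field_derivative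
      (of_real b + z) ^ 3 * exp (c * z)) (at z)" for z
      using c0
      by (auto intro!: derivative_eq_intros simp: field_simps power2_eq_square power3_eq_cube power4_eq_xxxx)
    from has_vector_derivative_real_field[OF this] show ?thesis
      unfolding F1_def by (auto simp: F1_def[abs_def])
  qed
  have d2: "(F2 has_vector_derivative (of_real b - of_real t) ^ 3 * ?E t) (at t within S)" for t S
  proof -
    have "((\<lambda>z. ((of_real b - z) ^ 3 / c + 3 * (of_real b - z)\<^sup>2 / c\<^sup>2
      + 6 * (of_real b - z) / c ^ 3 + 6 / c ^ 4) * exp (c * z)) has_field_derivative
      (of_real b - z) ^ 3 * exp (c * z)) (at z)" for z
      using c0
      by (auto intro!: derivative_eq_intros simp: field_simps power2_eq_square power3_eq_cube power4_eq_xxxx)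
    from has_vector_derivative_real_field[OF this] show ?thesis
      unfolding F2_def by (auto simp: F2_def[abs_def])
  qed
  have "has_bochner_integral lborel (\<lambda>t. indicator {-b..0} t *\<^sub>R ((of_real b + of_real t) ^ 3 * ?E t)
      + indicator {0..b} t *\<^sub>R ((of_real b - of_real t) ^ 3 * ?E t)) ((F1 0 - F1 (-b)) + (F2 b - F2 0))"
    using assms by (intro has_bochner_integral_add has_bochner_integral_FTC_Icc d1 d2 continuous_intros) auto
  also have "?this \<longleftrightarrow> has_bochner_integral lborel
    (\<lambda>t. complex_of_real (max 0 (b - \<bar>t\<bar>) ^ 3) * exp (- (\<i> * of_real (x * t))))
    ((F1 0 - F1 (-b)) + (F2 b - F2 0))"
  proof (rule has_bochner_integral_cong_AE)
    show "AE t in lborel. indicator {-b..0} t *\<^sub>R ((of_real b + of_real t) ^ 3 * ?E t)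
      + indicator {0..b} t *\<^sub>R ((of_real b - of_real t) ^ 3 * ?E t) =
      complex_of_real (max 0 (b - \<bar>t\<bar>) ^ 3) * exp (- (\<i> * of_real (x * t)))"
      using AE_lborel_singleton[of 0]
    proof eventually_elim
      case (elim t)
      consider "t < -b" | "-b \<le> t \<and> t < 0" | "0 < t \<and> t \<le> b" | "b < t" using elim by linarith
      then show ?case using assms by cases (auto simp: c_def max_def abs_if mult_ac)
    qed
  qed measurable
  also have "(F1 0 - F1 (-b)) + (F2 b - F2 0) =
      of_real (6 * b\<^sup>2 / x\<^sup>2 - 12 * (1 - cos (b * x)) / x ^ 4)"
  proof -
    have c2: "c\<^sup>2 = - of_real (x\<^sup>2)" by (simp add: c_def power_mult_distrib)
    have c4: "c ^ 4 = of_real (x ^ 4)"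
    proof -
      have "c ^ 4 = (c\<^sup>2)\<^sup>2" by simp
      then show ?thesis by (simp only: c2) (simp flip: of_real_power)
    qed
    have "cos (complex_of_real (b * x)) = (exp (\<i> * of_real (b * x)) + exp (- (\<i> * of_real (b * x)))) / 2"
      by (rule cos_exp_eq)
    then have cs: "?E b + ?E (-b) = 2 * of_real (cos (b * x))"
      unfolding cos_of_real[symmetric] by (simp add: c_def mult_ac)
    have "(F1 0 - F1 (-b)) + (F2 b - F2 0) = - 6 * of_real (b\<^sup>2) / c\<^sup>2 - 12 / c ^ 4 + 6 * (?E b + ?E (-b)) / c ^ 4"
      using c0 by (simp add: F1_def F2_def field_simps)
    also have "\<dots> = of_real (6 * b\<^sup>2 / x\<^sup>2 - 12 * (1 - cos (b * x)) / x ^ 4)"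
      unfolding c2 c4 cs by (simp add: algebra_simps diff_divide_distrib add_divide_distrib)
    finally show ?thesis .
  qed
  finally show ?thesis .
qed

text \<open>The terms of order \<open>x ^ -2\<close> of the two cubic hats cancel, and the remaining combination of cosines is a
  fourth power of a sine.\<close>

lemma jackson_fourier:
  fixes x :: real
  assumes "x \<noteq> 0"
  shows "has_bochner_integral lborel
    (\<lambda>t. complex_of_real (parzen t) * exp (- (\<i> * of_real (x * t)))) (of_real (2 * pi * jackson x))"
proof -
  have "has_bochner_integral lborel
    (\<lambda>t. 2 * (complex_of_real (max 0 (1 - \<bar>t\<bar>) ^ 3) * exp (- (\<i> * of_real (x * t))))
      - 8 * (complex_of_real (max 0 (1/2 - \<bar>t\<bar>) ^ 3) * exp (- (\<i> * of_real (x * t)))))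
    (2 * of_real (6 * 1\<^sup>2 / x\<^sup>2 - 12 * (1 - cos (1 * x)) / x ^ 4)
     - 8 * of_real (6 * (1/2)\<^sup>2 / x\<^sup>2 - 12 * (1 - cos (1/2 * x)) / x ^ 4))"
    using assms by (intro has_bochner_integral_diff has_bochner_integral_mult_right cubic_hat_fourier) auto
  also have "(\<lambda>t. 2 * (complex_of_real (max 0 (1 - \<bar>t\<bar>) ^ 3) * exp (- (\<i> * of_real (x * t))))
      - 8 * (complex_of_real (max 0 (1/2 - \<bar>t\<bar>) ^ 3) * exp (- (\<i> * of_real (x * t))))) =
      (\<lambda>t. complex_of_real (parzen t) * exp (- (\<i> * of_real (x * t))))"
    by (simp add: parzen_def fun_eq_iff algebra_simps)
  also have "2 * of_real (6 * 1\<^sup>2 / x\<^sup>2 - 12 * (1 - cos (1 * x)) / x ^ 4)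
     - 8 * of_real (6 * (1/2)\<^sup>2 / x\<^sup>2 - 12 * (1 - cos (1/2 * x)) / x ^ 4) =
     complex_of_real (2 * (6 * 1\<^sup>2 / x\<^sup>2 - 12 * (1 - cos (1 * x)) / x ^ 4)
     - 8 * (6 * (1/2)\<^sup>2 / x\<^sup>2 - 12 * (1 - cos (1/2 * x)) / x ^ 4))"
    by simp
  also have "2 * (6 * 1\<^sup>2 / x\<^sup>2 - 12 * (1 - cos (1 * x)) / x ^ 4)
     - 8 * (6 * (1/2)\<^sup>2 / x\<^sup>2 - 12 * (1 - cos (1/2 * x)) / x ^ 4) = 2 * pi * jackson x"
  proof -
    define s where "s = sin (x / 4)"
    have c2: "cos (x / 2) = 1 - 2 * s\<^sup>2"
      using cos_double_sin[of "x / 4"] by (simp add: s_def)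
    have c1: "cos x = 2 * (cos (x / 2))\<^sup>2 - 1"
      using cos_double_cos[of "x / 2"] by simp
    have "24 * (cos x - 1) + 96 * (1 - cos (x / 2)) = 192 * s ^ 4"
      unfolding c1 c2 by (simp add: power2_eq_square power4_eq_xxxx algebra_simps)
    then have "2 * pi * jackson x = (24 * (cos x - 1) + 96 * (1 - cos (x / 2))) / x ^ 4"
      by (simp add: jackson_def s_def)
    then show ?thesis
      by (simp add: power2_eq_square diff_divide_distrib add_divide_distrib algebra_simps)
  qed
  finally show ?thesis .
qed

lemma parzen_0 [simp]: "parzen 0 = 1"
  by (simp add: parzen_def power3_eq_cube)

lemma parzen_eq_0: "\<bar>t\<bar> \<ge> 1 \<Longrightarrow> parzen t = 0"
  by (simp add: parzen_def)

lemma continuous_parzen [continuous_intros]: "continuous_on S parzen"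
  unfolding parzen_def by (intro continuous_intros)

lemma measurable_parzen [measurable]: "parzen \<in> borel_measurable borel"
  by (intro borel_measurable_continuous_onI continuous_parzen)

lemma abs_parzen_le: "\<bar>parzen t\<bar> \<le> 1"
proof -
  define s where "s = \<bar>t\<bar>"
  have s: "s \<ge> 0" by (simp add: s_def)
  consider "s \<ge> 1" | "1/2 \<le> s \<and> s < 1" | "s < 1/2" by linarith
  then show ?thesis
  proof cases
    case 1 then show ?thesis by (simp add: parzen_eq_0 s_def)
  next
    case 2
    then have "parzen t = 2 * (1 - s) ^ 3" by (simp add: parzen_def s_def max_def)
    moreover have "(1 - s) ^ 3 \<le> (1/2) ^ 3" using 2 by (intro power_mono) auto
    moreover have "0 \<le> (1 - s) ^ 3" using 2 by simp
    ultimately show ?thesis by (simp add: power3_eq_cube)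
  next
    case 3
    then have "parzen t = 2 * (1 - s) ^ 3 - 8 * (1/2 - s) ^ 3" by (simp add: parzen_def s_def max_def)
    also have "\<dots> = 1 - 6 * (s * s * (1 - s))" by (simp add: power3_eq_cube field_simps)
    finally have p: "parzen t = 1 - 6 * (s * s * (1 - s))" .
    have "s * s \<le> 1/2 * (1/2)" using 3 s by (intro mult_mono) auto
    then have "s * s * (1 - s) \<le> 1/4 * 1" using 3 s by (intro mult_mono) auto
    moreover have "0 \<le> s * s * (1 - s)" using 3 s by simp
    ultimately show ?thesis unfolding p by (simp add: abs_le_iff)
  qed
qed

lemma integrable_parzen_mult:
  assumes [measurable]: "g \<in> borel_measurable borel" and "\<And>t. cmod (g t) \<le> B"
  shows "integrable lborel (\<lambda>t. complex_of_real (parzen t) * g t)"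
proof (rule integrableI_bounded_set[where A = "{-1..1}" and B = B])
  show "AE t in lborel. t \<in> {-1..1} \<longrightarrow> cmod (complex_of_real (parzen t) * g t) \<le> B"
  proof (rule AE_I2, rule impI)
    fix t :: real
    have "cmod (complex_of_real (parzen t) * g t) \<le> 1 * B"
      unfolding norm_mult using abs_parzen_le assms(2) by (intro mult_mono) auto
    then show "cmod (complex_of_real (parzen t) * g t) \<le> B" by simp
  qed
qed (auto simp: parzen_eq_0)

lemma jackson_nonneg [simp]: "0 \<le> jackson x"
  by (simp add: jackson_def)

lemma jackson_minus [simp]: "jackson (- x) = jackson x"
  by (simp add: jackson_def)

lemma measurable_jackson [measurable]: "jackson \<in> borel_measurable borel"
  unfolding jackson_def by measurable

lemma jackson_le_const: "jackson x \<le> 3 / (8 * pi)"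
proof (cases "x = 0")
  case False
  have "\<bar>sin (x / 4)\<bar> ^ 4 \<le> \<bar>x / 4\<bar> ^ 4" by (intro power_mono abs_sin_x_le_abs_x) auto
  then have "sin (x / 4) ^ 4 \<le> x ^ 4 / 256" by (simp add: power_divide)
  then have "sin (x / 4) ^ 4 / x ^ 4 \<le> 1 / 256" using False by (simp add: field_simps)
  then have "96 / pi * (sin (x / 4) ^ 4 / x ^ 4) \<le> 96 / pi * (1 / 256)"
    by (intro mult_left_mono) auto
  then show ?thesis by (simp add: jackson_def)
qed (simp add: jackson_def)

lemma jackson_le_power4: "jackson x \<le> 96 / (pi * x ^ 4)"
proof -
  have "\<bar>sin (x / 4)\<bar> ^ 4 \<le> 1 ^ 4" by (intro power_mono) auto
  then have "96 / pi * sin (x / 4) ^ 4 / x ^ 4 \<le> 96 / pi * 1 / x ^ 4"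
    by (intro divide_right_mono mult_left_mono) auto
  then show ?thesis by (simp add: jackson_def)
qed

lemma integrable_inverse_1_plus_square_UNIV: "integrable lborel (\<lambda>x::real. 1 / (1 + x\<^sup>2))"
  and integral_inverse_1_plus_square_UNIV: "(\<integral>x. 1 / (1 + x\<^sup>2) \<partial>lborel) = pi"
  using integrable_inverse_1_plus_square LBINT_inverse_1_plus_square
  by (simp_all add: set_integrable_def interval_lebesgue_integral_def set_lebesgue_integral_def
      einterval_def divide_inverse)

lemma integrable_jackson: "integrable lborel jackson"
proof (rule Bochner_Integration.integrable_bound)
  \<comment> \<open>for \<open>\<bar>x\<bar> \<ge> 1\<close> we have \<open>1 + x\<^sup>2 \<le> 2 x ^ 4\<close>, whence \<open>192 = 2 \<cdot> 96\<close>; for smaller \<open>x\<close> there is ample room\<close>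
  show "integrable lborel (\<lambda>x::real. 192 / pi * (1 / (1 + x\<^sup>2)))"
    using integrable_inverse_1_plus_square_UNIV by (rule integrable_mult_right)
  have "jackson x \<le> 192 / pi * (1 / (1 + x\<^sup>2))" for x
  proof (cases "\<bar>x\<bar> \<le> 1")
    case True
    then have "x\<^sup>2 \<le> 1" by (simp add: abs_square_le_1)
    then have "3 / (8 * pi) \<le> 192 / (pi * (1 + x\<^sup>2))"
      by (simp add: field_simps add_pos_nonneg)
    then show ?thesis using jackson_le_const[of x] by simp
  next
    case False
    then have x2: "1 \<le> x\<^sup>2" using one_le_power[of "\<bar>x\<bar>" 2] by simp
    then have "1 * x\<^sup>2 \<le> x\<^sup>2 * x\<^sup>2" by (intro mult_right_mono) auto
    then have "1 + x\<^sup>2 \<le> 2 * x ^ 4" using x2 by (simp add: power4_eq_xxxx power2_eq_square)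
    then have "192 / (pi * (2 * x ^ 4)) \<le> 192 / (pi * (1 + x\<^sup>2))"
      using x2 by (intro divide_left_mono mult_left_mono) (auto simp: add_pos_nonneg zero_less_mult_iff)
    then have "96 / (pi * x ^ 4) \<le> 192 / (pi * (1 + x\<^sup>2))" by simp
    then show ?thesis using jackson_le_power4[of x] by simp
  qed
  then show "AE x in lborel. norm (jackson x) \<le> norm (192 / pi * (1 / (1 + x\<^sup>2)))"
    by (simp add: add_nonneg_nonneg)
qed simp

text \<open>This is \<open>\<integral> e ^ (- \<epsilon> (u - x)) p(x) dx\<close> over \<open>x < u\<close>, with \<open>y = u - x\<close> as the integration variable;
  for \<open>\<epsilon> = 0\<close> it is the distribution function of \<open>p\<close>.\<close>

definition damped_cdf :: "real \<Rightarrow> real \<Rightarrow> real" where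
  "damped_cdf \<epsilon> u = (\<integral>y. indicator {0<..} y * exp (- (\<epsilon> * y)) * jackson (u - y) \<partial>lborel)"

lemma integrable_exp_Ioi: "\<epsilon> > 0 \<Longrightarrow> integrable lborel (\<lambda>y::real. indicator {0<..} y * exp (- (\<epsilon> * y)) :: real)"
  using integrable_I0i_exp_mscale[of \<epsilon>] by (simp add: set_integrable_def mult_ac)

lemma laplace_exp:
  fixes \<epsilon> t :: real
  assumes "\<epsilon> > 0"
  shows "(\<integral>y. indicator {0<..} y *\<^sub>R exp (- ((of_real \<epsilon> - \<i> * of_real t) * of_real y)) \<partial>lborel)
    = 1 / (of_real \<epsilon> - \<i> * of_real t)"
proof -
  define w where "w = of_real \<epsilon> - \<i> * complex_of_real t"
  have Re: "Re w = \<epsilon>" by (simp add: w_def)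
  then have w0: "w \<noteq> 0" using assms by auto
  let ?F = "\<lambda>y::real. - exp (- (w * of_real y)) / w"
  have "(LBINT y=0..\<infinity>. exp (- (w * of_real y))) = 0 - (- 1 / w)"
  proof (rule interval_integral_FTC_integrable[where F = ?F])
    show "(?F has_vector_derivative exp (- (w * of_real y))) (at y)" for y
      by (rule has_vector_derivative_real_field)
        (use w0 in \<open>auto intro!: derivative_eq_intros\<close>)
    show "set_integrable lborel (einterval 0 \<infinity>) (\<lambda>y. exp (- (w * of_real y)))"
      unfolding set_integrable_def
    proof (rule Bochner_Integration.integrable_bound[OF integrable_exp_Ioi[OF assms]])
      show "AE y in lborel. norm (indicator (einterval 0 \<infinity>) y *\<^sub>R exp (- (w * complex_of_real y)))
           \<le> norm (indicator {0<..} y * exp (- (\<epsilon> * y)) :: real)"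
        by (auto simp: norm_mult Re zero_ereal_def einterval_def split: split_indicator)
    qed (simp add: zero_ereal_def einterval_def)
    show "((?F \<circ> real_of_ereal) \<longlongrightarrow> - 1 / w) (at_right 0)"
      unfolding zero_ereal_def ereal_tendsto_simps using w0 by (auto intro!: tendsto_eq_intros)
    show "((?F \<circ> real_of_ereal) \<longlongrightarrow> 0) (at_left \<infinity>)"
      unfolding ereal_tendsto_simps
    proof (rule tendsto_norm_zero_cancel)
      have "((\<lambda>y. exp (- (\<epsilon> * y)) / cmod w) \<longlongrightarrow> 0 / cmod w) at_top"
      proof (intro tendsto_intros)
        show "((\<lambda>y. exp (- (\<epsilon> * y))) \<longlongrightarrow> 0) at_top"
          using assms by (auto intro!: exp_at_bot[THEN filterlim_compose] filterlim_tendsto_pos_mult_at_top filterlim_ident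
             simp: filterlim_uminus_at_bot)
      qed (use w0 in auto)
      then show "((\<lambda>y. norm (?F y)) \<longlongrightarrow> 0) at_top" by (simp add: norm_divide Re)
    qed
  qed auto
  then show ?thesis
    by (simp add: interval_lebesgue_integral_0_infty set_lebesgue_integral_def w_def)
qed

text \<open>Insert the Fourier representation of the kernel and exchange the integrals; the damping makes the
  double integral absolutely convergent and produces the factor \<open>1 / (\<epsilon> - \<i> t)\<close>.\<close>

lemma damped_cdf_fourier:
  assumes "\<epsilon> > 0"
  shows "of_real (2 * pi * damped_cdf \<epsilon> u) =
    (\<integral>t. of_real (parzen t) * (exp (- (\<i> * of_real (u * t))) / (of_real \<epsilon> - \<i> * of_real t)) \<partial>lborel)"
proof -
  define f where "f y t = complex_of_real (indicator {0<..} y * exp (- (\<epsilon> * y))) *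
      (of_real (parzen t) * exp (- (\<i> * of_real ((u - y) * t))))" for y t :: real
  have nf: "cmod (f y t) = indicator {0<..} y * exp (- (\<epsilon> * y)) * \<bar>parzen t\<bar>" for y t
    by (simp add: f_def norm_mult)
  have ip: "integrable lborel (\<lambda>t. \<bar>parzen t\<bar>)"
    using integrable_parzen_mult[of "\<lambda>_. 1" 1] integrable_norm by fastforce
  have int: "integrable (lborel \<Otimes>\<^sub>M lborel) (case_prod f)"
  proof (rule lborel_pair.Fubini_integrable)
    show "case_prod f \<in> borel_measurable (lborel \<Otimes>\<^sub>M lborel)"
      unfolding f_def by measurable
    show "integrable lborel (\<lambda>y. \<integral>t. norm (case (y, t) of (y, t) \<Rightarrow> f y t) \<partial>lborel)"
      using integrable_exp_Ioi[OF assms] by (simp add: nf integrable_mult_left)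
    show "AE y in lborel. integrable lborel (\<lambda>t. case (y, t) of (y, t) \<Rightarrow> f y t)"
    proof (rule AE_I2)
      fix y :: real
      have "integrable lborel (\<lambda>t. complex_of_real (parzen t) * exp (- (\<i> * of_real ((u - y) * t))))"
        by (rule integrable_parzen_mult[where B = 1]) auto
      then show "integrable lborel (\<lambda>t. case (y, t) of (y, t) \<Rightarrow> f y t)"
        unfolding f_def prod.case by (rule integrable_mult_right)
    qed
  qed
  have "(\<integral>t. (\<integral>y. f y t \<partial>lborel) \<partial>lborel) = (\<integral>y. (\<integral>t. f y t \<partial>lborel) \<partial>lborel)"
    by (rule lborel_pair.Fubini_integral[OF int])
  also have "\<dots> = (\<integral>y. of_real (2 * pi * (indicator {0<..} y * exp (- (\<epsilon> * y)) * jackson (u - y))) \<partial>lborel)"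
  proof (rule integral_cong_AE)
    show "AE y in lborel. (\<integral>t. f y t \<partial>lborel) =
        of_real (2 * pi * (indicator {0<..} y * exp (- (\<epsilon> * y)) * jackson (u - y)))"
      using AE_lborel_singleton[of u]
    proof eventually_elim
      case (elim y)
      have h: "(\<integral>t. complex_of_real (parzen t) * exp (- (\<i> * of_real ((u - y) * t))) \<partial>lborel) =
          of_real (2 * pi * jackson (u - y))"
        by (rule has_bochner_integral_integral_eq[OF jackson_fourier]) (use elim in simp)
      show ?case unfolding f_def integral_mult_right_zero h by simp
    qed
    show "(\<lambda>y. \<integral>t. f y t \<partial>lborel) \<in> borel_measurable lborel"
      by (rule borel_measurable_integrable[OF lborel_pair.integrable_fst[OF int]])
  qed measurable
  also have "\<dots> = of_real (2 * pi * damped_cdf \<epsilon> u)"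
    unfolding damped_cdf_def by (simp only: integral_complex_of_real integral_mult_right_zero)
  finally have eq: "of_real (2 * pi * damped_cdf \<epsilon> u) = (\<integral>t. (\<integral>y. f y t \<partial>lborel) \<partial>lborel)" ..
  have "(\<integral>y. f y t \<partial>lborel) =
      of_real (parzen t) * (exp (- (\<i> * of_real (u * t))) / (of_real \<epsilon> - \<i> * of_real t))" for t
  proof -
    have "f y t = of_real (parzen t) * exp (- (\<i> * of_real (u * t))) *
        (indicator {0<..} y *\<^sub>R exp (- ((of_real \<epsilon> - \<i> * of_real t) * of_real y)))" for y
      by (auto simp: f_def exp_of_real[symmetric] exp_add[symmetric] algebra_simps split: split_indicator)
    then show ?thesis
      by (simp only: integral_mult_right_zero laplace_exp[OF assms]) simp
  qed
  then show ?thesis by (simp only: eq)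
qed

section \<open>Mass, tails and first moment of the kernel\<close>

lemma damped_cdf_tendsto:
  "(\<lambda>n. damped_cdf (inverse (real (Suc n))) u) \<longlonglongrightarrow> (\<integral>y. indicator {0<..} y * jackson (u - y) \<partial>lborel)"
  unfolding damped_cdf_def
proof (rule integral_dominated_convergence[where w = "\<lambda>y. jackson (u - y)"])
  show "integrable lborel (\<lambda>y. jackson (u - y))"
    using lborel_integrable_real_affine[OF integrable_jackson, of "-1" u] by simp
  show "AE y in lborel. (\<lambda>n. indicator {0<..} y * exp (- (inverse (real (Suc n)) * y)) * jackson (u - y))
      \<longlonglongrightarrow> indicator {0<..} y * jackson (u - y)"
  proof (rule AE_I2)
    fix y :: real
    have "(\<lambda>n. indicator {0<..} y * exp (- (inverse (real (Suc n)) * y)) * jackson (u - y))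
      \<longlonglongrightarrow> indicator {0<..} y * exp (- (0 * y)) * jackson (u - y)"
      by (intro tendsto_intros LIMSEQ_inverse_real_of_nat)
    then show "(\<lambda>n. indicator {0<..} y * exp (- (inverse (real (Suc n)) * y)) * jackson (u - y))
      \<longlonglongrightarrow> indicator {0<..} y * jackson (u - y)" by simp
  qed
  show "AE y in lborel. norm (indicator {0<..} y * exp (- (inverse (real (Suc n)) * y)) * jackson (u - y))
      \<le> jackson (u - y)" for n
    by (rule AE_I2) (auto intro!: mult_left_le_one_le split: split_indicator)
qed simp_all

text \<open>At \<open>u = 0\<close> the real part of \<open>1 / (\<epsilon> - \<i> t)\<close> is a Poisson kernel, rescaled here by
  \<open>t = \<epsilon> s\<close>. As \<open>\<epsilon>\<close> tends to \<open>0\<close> the right-hand side tends to \<open>\<pi>\<close>, which yields the mass of the kernel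
  without evaluating the integral of \<open>(sin x / x) ^ 4\<close>.\<close>

lemma damped_cdf_0:
  assumes "\<epsilon> > 0"
  shows "2 * pi * damped_cdf \<epsilon> 0 = (\<integral>s. parzen (\<epsilon> * s) * (1 / (1 + s\<^sup>2)) \<partial>lborel)"
proof -
  let ?g = "\<lambda>t. complex_of_real (parzen t) * (1 / (of_real \<epsilon> - \<i> * of_real t))"
  have den: "\<epsilon> \<le> cmod (of_real \<epsilon> - \<i> * of_real t)" for t
    using complex_Re_le_cmod[of "of_real \<epsilon> - \<i> * of_real t"] by simp
  have int: "integrable lborel ?g"
  proof (rule integrable_parzen_mult[where B = "1 / \<epsilon>"])
    show "cmod (1 / (of_real \<epsilon> - \<i> * of_real t)) \<le> 1 / \<epsilon>" for t
      using den[of t] assms by (simp add: norm_divide frac_le)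
  qed simp
  have "complex_of_real (2 * pi * damped_cdf \<epsilon> 0) = (\<integral>t. ?g t \<partial>lborel)"
    using damped_cdf_fourier[OF assms, of 0] by simp
  then have "Re (of_real (2 * pi * damped_cdf \<epsilon> 0)) = Re (\<integral>t. ?g t \<partial>lborel)" by (rule arg_cong)
  then have "2 * pi * damped_cdf \<epsilon> 0 = (\<integral>t. Re (?g t) \<partial>lborel)"
    using integral_Re[OF int] by simp
  also have "\<dots> = \<bar>\<epsilon>\<bar> *\<^sub>R (\<integral>s. Re (?g (0 + \<epsilon> * s)) \<partial>lborel)"
    using assms by (intro lborel_integral_real_affine) auto
  also have "\<dots> = (\<integral>s. \<epsilon> * Re (?g (0 + \<epsilon> * s)) \<partial>lborel)"
    using assms by simp
  also have "\<dots> = (\<integral>s. parzen (\<epsilon> * s) * (1 / (1 + s\<^sup>2)) \<partial>lborel)"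
  proof (rule Bochner_Integration.integral_cong[OF refl])
    fix s :: real
    have "Re (1 / (of_real \<epsilon> - \<i> * of_real (\<epsilon> * s))) = \<epsilon> / (\<epsilon>\<^sup>2 + (\<epsilon> * s)\<^sup>2)"
      by (simp add: Re_divide)
    also have "\<epsilon>\<^sup>2 + (\<epsilon> * s)\<^sup>2 = \<epsilon> * (\<epsilon> * (1 + s\<^sup>2))" by (simp add: power2_eq_square algebra_simps)
    finally have "\<epsilon> * Re (1 / (of_real \<epsilon> - \<i> * of_real (\<epsilon> * s))) = 1 / (1 + s\<^sup>2)"
      using assms by simp
    moreover have "Re (?g (0 + \<epsilon> * s)) = parzen (\<epsilon> * s) * Re (1 / (of_real \<epsilon> - \<i> * of_real (\<epsilon> * s)))"
      by (simp only: Re_complex_of_real add_0 times_complex.sel Im_complex_of_real mult_zero_left diff_zero)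
    ultimately show "\<epsilon> * Re (?g (0 + \<epsilon> * s)) = parzen (\<epsilon> * s) * (1 / (1 + s\<^sup>2))"
      by (metis mult.left_commute)
  qed
  finally show ?thesis .
qed

lemma integral_jackson_half: "(\<integral>y. indicator {0<..} y * jackson y \<partial>lborel) = 1 / 2"
proof -
  have "(\<lambda>n. 2 * pi * damped_cdf (inverse (real (Suc n))) 0) \<longlonglongrightarrow> 2 * pi * (\<integral>y. indicator {0<..} y * jackson (0 - y) \<partial>lborel)"
    by (intro tendsto_intros damped_cdf_tendsto)
  then have "(\<lambda>n. \<integral>s. parzen (inverse (real (Suc n)) * s) * (1 / (1 + s\<^sup>2)) \<partial>lborel)
      \<longlonglongrightarrow> 2 * pi * (\<integral>y. indicator {0<..} y * jackson y \<partial>lborel)"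
    by (simp add: damped_cdf_0)
  moreover have "(\<lambda>n. \<integral>s. parzen (inverse (real (Suc n)) * s) * (1 / (1 + s\<^sup>2)) \<partial>lborel)
      \<longlonglongrightarrow> (\<integral>s. 1 / (1 + s\<^sup>2) \<partial>lborel)"
  proof (rule integral_dominated_convergence[where w = "\<lambda>s. 1 / (1 + s\<^sup>2)"])
    show "AE s in lborel. (\<lambda>n. parzen (inverse (real (Suc n)) * s) * (1 / (1 + s\<^sup>2))) \<longlonglongrightarrow> 1 / (1 + s\<^sup>2)"
    proof (rule AE_I2)
      fix s :: real
      have "isCont parzen 0" using continuous_parzen[of UNIV] by (simp add: continuous_on_eq_continuous_at)
      then have "(\<lambda>n. parzen (inverse (real (Suc n)) * s)) \<longlonglongrightarrow> parzen 0"
        by (rule isCont_tendsto_compose) (use tendsto_mult_left_zero[OF LIMSEQ_inverse_real_of_nat] in auto)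
      then have "(\<lambda>n. parzen (inverse (real (Suc n)) * s) * (1 / (1 + s\<^sup>2))) \<longlonglongrightarrow> parzen 0 * (1 / (1 + s\<^sup>2))"
        by (intro tendsto_intros)
      then show "(\<lambda>n. parzen (inverse (real (Suc n)) * s) * (1 / (1 + s\<^sup>2))) \<longlonglongrightarrow> 1 / (1 + s\<^sup>2)" by simp
    qed
    show "AE s in lborel. norm (parzen (inverse (real (Suc n)) * s) * (1 / (1 + s\<^sup>2))) \<le> 1 / (1 + s\<^sup>2)" for n
    proof (rule AE_I2)
      fix s :: real
      have "\<bar>parzen (inverse (real (Suc n)) * s)\<bar> * (1 / (1 + s\<^sup>2)) \<le> 1 * (1 / (1 + s\<^sup>2))"
        by (intro mult_right_mono abs_parzen_le) simp
      then show "norm (parzen (inverse (real (Suc n)) * s) * (1 / (1 + s\<^sup>2))) \<le> 1 / (1 + s\<^sup>2)"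
        unfolding real_norm_def abs_mult by (simp add: abs_of_nonneg)
    qed
  qed (simp_all add: integrable_inverse_1_plus_square_UNIV)
  ultimately have "2 * pi * (\<integral>y. indicator {0<..} y * jackson y \<partial>lborel) = (\<integral>s. 1 / (1 + s\<^sup>2) \<partial>lborel)"
    by (rule LIMSEQ_unique)
  also have "\<dots> = pi" by (rule integral_inverse_1_plus_square_UNIV)
  finally show ?thesis by simp
qed

definition jackson_measure :: "real measure" where
  "jackson_measure = density lborel (\<lambda>x. ennreal (jackson x))"

lemma sets_jackson_measure [simp, measurable_cong]: "sets jackson_measure = sets borel"
  by (simp add: jackson_measure_def)

lemma space_jackson_measure [simp]: "space jackson_measure = UNIV"
  by (simp add: jackson_measure_def)

lemma nn_integral_even:
  fixes f :: "real \<Rightarrow> ennreal"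
  assumes [measurable]: "f \<in> borel_measurable borel" and even: "\<And>x. f (- x) = f x"
  shows "(\<integral>\<^sup>+x. f x \<partial>lborel) = 2 * (\<integral>\<^sup>+x. f x * indicator {0..} x \<partial>lborel)"
proof -
  have "(\<integral>\<^sup>+x. f x \<partial>lborel) = (\<integral>\<^sup>+x. f x * indicator {0..} x + f x * indicator {..0} x \<partial>lborel)"
    using AE_lborel_singleton[of 0]
    by (intro nn_integral_cong_AE) (auto elim!: eventually_mono split: split_indicator)
  also have "\<dots> = (\<integral>\<^sup>+x. f x * indicator {0..} x \<partial>lborel) + (\<integral>\<^sup>+x. f x * indicator {..0} x \<partial>lborel)"
    by (rule nn_integral_add) auto
  also have "(\<integral>\<^sup>+x. f x * indicator {..0} x \<partial>lborel) = (\<integral>\<^sup>+x. f x * indicator {0..} x \<partial>lborel)"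
    by (subst nn_integral_real_affine[where c = "-1" and t = 0])
      (auto simp: even indicator_def intro!: nn_integral_cong)
  finally show ?thesis by (simp add: mult_2)
qed

lemma prob_space_jackson_measure: "prob_space jackson_measure"
proof
  have "integrable lborel (\<lambda>y. indicator {0<..} y * jackson y)"
    using integrable_real_mult_indicator[OF _ integrable_jackson, of "{0<..}"] by (simp add: mult.commute)
  then have "(\<integral>\<^sup>+y. ennreal (indicator {0<..} y * jackson y) \<partial>lborel) = ennreal (1 / 2)"
    by (subst nn_integral_eq_integral) (auto simp: integral_jackson_half)
  also have "(\<integral>\<^sup>+y. ennreal (indicator {0<..} y * jackson y) \<partial>lborel) =
      (\<integral>\<^sup>+y. ennreal (jackson y) * indicator {0..} y \<partial>lborel)"
    using AE_lborel_singleton[of 0]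
    by (intro nn_integral_cong_AE) (auto elim!: eventually_mono split: split_indicator)
  finally have "(\<integral>\<^sup>+y. ennreal (jackson y) \<partial>lborel) = 2 * ennreal (1 / 2)"
    by (subst nn_integral_even) auto
  also have "\<dots> = ennreal 2 * ennreal (1 / 2)" by simp
  also have "\<dots> = ennreal (2 * (1 / 2))" by (rule ennreal_mult[symmetric]) auto
  also have "\<dots> = 1" by simp
  finally show "emeasure jackson_measure (space jackson_measure) = 1"
    by (simp add: jackson_measure_def emeasure_density)
qed

lemma jackson_cdf:
  "(\<integral>y. indicator {0<..} y * jackson (u - y) \<partial>lborel) = measure jackson_measure {..u}"
proof -
  have "(\<integral>y. indicator {0<..} y * jackson (u - y) \<partial>lborel) =
      \<bar>-1\<bar> *\<^sub>R (\<integral>x. indicator {0<..} (u + (-1) * x) * jackson (u - (u + (-1) * x)) \<partial>lborel)"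
    by (rule lborel_integral_real_affine) simp
  also have "\<dots> = (\<integral>x. jackson x *\<^sub>R indicator {..u} x \<partial>lborel)"
  proof -
    have "(\<integral>x. indicator {0<..} (u + (-1) * x) * jackson (u - (u + (-1) * x)) \<partial>lborel) =
      (\<integral>x. jackson x *\<^sub>R indicator {..u} x \<partial>lborel)"
      using AE_lborel_singleton[of u]
      by (intro integral_cong_AE) (auto elim!: eventually_mono split: split_indicator)
    then show ?thesis by simp
  qed
  also have "\<dots> = (\<integral>x. indicator {..u} x \<partial>jackson_measure)"
    unfolding jackson_measure_def by (subst integral_density) auto
  also have "\<dots> = measure jackson_measure {..u}"
    by simp
  finally show ?thesis .
qed

lemma damped_cdf_tendsto_cdf:
  "(\<lambda>n. damped_cdf (inverse (real (Suc n))) u) \<longlonglongrightarrow> measure jackson_measure {..u}"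
  using damped_cdf_tendsto[of u] by (simp only: jackson_cdf)

lemma damped_cdf_nonneg: "0 \<le> damped_cdf \<epsilon> u"
  unfolding damped_cdf_def by (intro integral_nonneg_AE AE_I2) auto

lemma damped_cdf_le_1:
  assumes "\<epsilon> > 0" shows "damped_cdf \<epsilon> u \<le> 1"
proof -
  interpret prob_space jackson_measure by (rule prob_space_jackson_measure)
  have i: "integrable lborel (\<lambda>y. jackson (u - y))"
    using lborel_integrable_real_affine[OF integrable_jackson, of "-1" u] by simp
  have j: "integrable lborel (\<lambda>y. indicator {0<..} y * jackson (u - y))"
    using integrable_real_mult_indicator[OF _ i, of "{0<..}"] by (simp add: mult.commute)
  have "damped_cdf \<epsilon> u \<le> (\<integral>y. indicator {0<..} y * jackson (u - y) \<partial>lborel)"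
    unfolding damped_cdf_def
  proof (rule integral_mono_AE[OF _ j])
    show le: "AE y in lborel. indicator {0<..} y * exp (- (\<epsilon> * y)) * jackson (u - y) \<le> indicator {0<..} y * jackson (u - y)"
      using assms by (auto intro!: AE_I2 mult_left_le_one_le split: split_indicator)
    show "integrable lborel (\<lambda>y. indicator {0<..} y * exp (- (\<epsilon> * y)) * jackson (u - y))"
      by (rule Bochner_Integration.integrable_bound[OF j]) (use le in \<open>auto elim!: eventually_mono\<close>)
  qed
  also have "\<dots> \<le> 1" unfolding jackson_cdf by (rule prob_le_1)
  finally show ?thesis .
qed

lemma measurable_damped_cdf [measurable]: "damped_cdf \<epsilon> \<in> borel_measurable borel"
proof -
  have "(\<lambda>u. \<integral>y. (case (u, y) of (u, y) \<Rightarrow> indicator {0<..} y * exp (- (\<epsilon> * y)) * jackson (u - y)) \<partial>lborel)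
      \<in> borel_measurable borel"
    by (intro lborel.borel_measurable_lebesgue_integral) measurable
  then show ?thesis by (simp add: damped_cdf_def[abs_def])
qed

text \<open>The sign \<open>\<sigma>\<close> covers both tails at once. The one-sided bound comes from \<open>p(x) \<le> 96 / (\<pi> x ^ 4)\<close>, and
  it is the origin of the number \<open>32 / \<pi>\<close> in \<open>C1\<close>.\<close>

lemma jackson_tail:
  assumes "a > 0" "\<bar>\<sigma>\<bar> = 1"
  shows "measure jackson_measure {x. \<sigma> * x \<le> a} \<ge> 1 - 32 / (pi * a ^ 3)"
proof -
  interpret prob_space jackson_measure by (rule prob_space_jackson_measure)
  have \<sigma>: "\<sigma> = 1 \<or> \<sigma> = -1" using assms by (auto simp: abs_if split: if_splits)
  have "emeasure jackson_measure {x. \<sigma> * x > a} = (\<integral>\<^sup>+x. ennreal (jackson x) * indicator {x. \<sigma> * x > a} x \<partial>lborel)"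
    unfolding jackson_measure_def by (rule emeasure_density) auto
  also have "\<dots> = (\<integral>\<^sup>+x. ennreal (jackson x) * indicator {a<..} x \<partial>lborel)"
    using \<sigma>
  proof
    assume "\<sigma> = -1"
    then show ?thesis
      by (subst nn_integral_real_affine[where c = "-1" and t = 0])
        (auto simp: indicator_def intro!: nn_integral_cong)
  qed (auto simp: indicator_def)
  \<comment> \<open>\<open>max a x\<close> equals \<open>x\<close> on the half-line and keeps the majorant away from its singularity at \<open>0\<close>\<close>
  also have "\<dots> \<le> (\<integral>\<^sup>+x. ennreal (96 / (pi * (max a x) ^ 4)) * indicator {a..} x \<partial>lborel)"
    using jackson_le_power4 by (intro nn_integral_mono) (auto split: split_indicator simp: max_def intro!: ennreal_leI)
  also have "\<dots> = ennreal (0 - (- 32 / (pi * a ^ 3)))"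
  proof (rule nn_integral_FTC_atLeast)
    show "((\<lambda>x. - 32 / (pi * x ^ 3)) has_real_derivative 96 / (pi * max a x ^ 4)) (at x)" if "a \<le> x" for x
      using that assms
      by (auto intro!: derivative_eq_intros simp: max_def field_simps power4_eq_xxxx power3_eq_cube power2_eq_square)
    show "((\<lambda>x. - 32 / (pi * x ^ 3)) \<longlongrightarrow> 0) at_top"
      by real_asymp
  qed auto
  finally have "measure jackson_measure {x. \<sigma> * x > a} \<le> 32 / (pi * a ^ 3)"
    unfolding emeasure_eq_measure using assms by (subst (asm) ennreal_le_iff) auto
  moreover have "{x. \<sigma> * x \<le> a} = space jackson_measure - {x. \<sigma> * x > a}" by auto
  ultimately show ?thesis using prob_compl[of "{x. \<sigma> * x > a}"] by simp
qed

text \<open>On either half-line, the bounds \<open>p(x) \<le> 3 / (8 \<pi>)\<close> up to \<open>4\<close> and \<open>p(x) \<le> 96 / (\<pi> x ^ 4)\<close> from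
  there on contribute \<open>3 / \<pi>\<close> each; the two bounds coincide at \<open>4\<close>.\<close>

lemma jackson_first_moment:
  shows "integrable jackson_measure (\<lambda>x. \<bar>x\<bar>)" and "(\<integral>x. \<bar>x\<bar> \<partial>jackson_measure) \<le> C2"
proof -
  have "(\<integral>\<^sup>+x. ennreal \<bar>x\<bar> \<partial>jackson_measure) = (\<integral>\<^sup>+x. ennreal (jackson x) * ennreal \<bar>x\<bar> \<partial>lborel)"
    unfolding jackson_measure_def by (rule nn_integral_density) auto
  also have "\<dots> = 2 * (\<integral>\<^sup>+x. ennreal (jackson x) * ennreal \<bar>x\<bar> * indicator {0..} x \<partial>lborel)"
    by (rule nn_integral_even) auto
  also have "(\<integral>\<^sup>+x. ennreal (jackson x) * ennreal \<bar>x\<bar> * indicator {0..} x \<partial>lborel) \<le>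
    (\<integral>\<^sup>+x. ennreal (3 / (8 * pi) * x) * indicator {0..4} x + ennreal (96 / (pi * (max 4 x) ^ 3)) * indicator {4..} x \<partial>lborel)"
  proof (rule nn_integral_mono)
    fix x :: real
    consider "x < 0" | "0 \<le> x \<and> x < 4" | "x \<ge> 4" by linarith
    then show "ennreal (jackson x) * ennreal \<bar>x\<bar> * indicator {0..} x \<le>
      ennreal (3 / (8 * pi) * x) * indicator {0..4} x + ennreal (96 / (pi * (max 4 x) ^ 3)) * indicator {4..} x"
    proof cases
      case 2
      then show ?thesis
        using mult_right_mono[OF jackson_le_const[of x], of x]
        by (auto simp: ennreal_mult[symmetric] intro!: ennreal_leI)
    next
      case 3
      have "jackson x * x \<le> 96 / (pi * x ^ 4) * x"
        using 3 jackson_le_power4[of x] by (intro mult_right_mono) auto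
      also have "\<dots> = 96 / (pi * x ^ 3)" using 3 by (simp add: power4_eq_xxxx power3_eq_cube)
      finally have "ennreal (jackson x) * ennreal \<bar>x\<bar> \<le> ennreal (96 / (pi * (max 4 x) ^ 3))"
        using 3 by (auto simp: ennreal_mult[symmetric] max_def intro!: ennreal_leI)
      then show ?thesis using 3 by (auto intro: order_trans simp: add_increasing)
    qed simp
  qed
  also have "\<dots> = (\<integral>\<^sup>+x. ennreal (3 / (8 * pi) * x) * indicator {0..4} x \<partial>lborel)
      + (\<integral>\<^sup>+x. ennreal (96 / (pi * (max 4 x) ^ 3)) * indicator {4..} x \<partial>lborel)"
    by (rule nn_integral_add) auto
  also have "(\<integral>\<^sup>+x. ennreal (3 / (8 * pi) * x) * indicator {0..4} x \<partial>lborel) =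
      ennreal (3 / (16 * pi) * 4\<^sup>2 - 3 / (16 * pi) * 0\<^sup>2)"
    by (rule nn_integral_FTC_Icc) (auto intro!: derivative_eq_intros)
  also have "(\<integral>\<^sup>+x. ennreal (96 / (pi * (max 4 x) ^ 3)) * indicator {4..} x \<partial>lborel) = 
      ennreal (0 - (- 48 / (pi * 4\<^sup>2)))"
  proof (rule nn_integral_FTC_atLeast)
    show "((\<lambda>x. - 48 / (pi * x\<^sup>2)) has_real_derivative 96 / (pi * max 4 x ^ 3)) (at x)" if "4 \<le> x" for x
      using that 
      by (auto intro!: derivative_eq_intros simp: max_def field_simps power3_eq_cube power2_eq_square)
    show "((\<lambda>x. - 48 / (pi * x\<^sup>2)) \<longlongrightarrow> 0) at_top"
      by real_asymp
  qed auto
  also have "2 * (ennreal (3 / (16 * pi) * 4\<^sup>2 - 3 / (16 * pi) * 0\<^sup>2) + ennreal (0 - (- 48 / (pi * 4\<^sup>2))))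
      = ennreal C2"
    by (simp add: C2_def ennreal_plus[symmetric] ennreal_mult[symmetric] flip: ennreal_numeral del: ennreal_plus)
  finally have le: "(\<integral>\<^sup>+x. ennreal \<bar>x\<bar> \<partial>jackson_measure) \<le> ennreal C2" by (simp add: mult_left_mono)
  show "integrable jackson_measure (\<lambda>x. \<bar>x\<bar>)"
    by (rule integrableI_bounded) (use le in \<open>auto intro: le_less_trans\<close>)
  show "(\<integral>x. \<bar>x\<bar> \<partial>jackson_measure) \<le> C2"
    by (rule integral_real_bounded) (use le in \<open>auto simp: C2_def\<close>)
qed

section \<open>Fourier integrals of damped distribution functions\<close>

lemma measurable_vec_nth [measurable]: "(\<lambda>t :: real ^ 'n. t $ l) \<in> borel_measurable borel"
  by (intro borel_measurable_continuous_onI continuous_intros)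

text \<open>The library describes Lebesgue measure on a Euclidean space as a product over \<open>Basis\<close>; this
  translates such products into products over the index type.\<close>

lemma prod_Basis_vec:
  fixes f :: "'n::finite \<Rightarrow> real \<Rightarrow> 'b::comm_monoid_mult"
  defines "g \<equiv> \<lambda>b :: real ^ 'n. f (THE l. axis l 1 = b)"
  shows "(\<Prod>b\<in>Basis. g b (h b)) = (\<Prod>l\<in>UNIV. f l (h (axis l 1)))"
proof -
  have g: "g (axis l 1) = f l" for l
    by (simp add: g_def axis_eq_axis)
  have B: "(Basis :: (real ^ 'n) set) = (\<lambda>l. axis l 1) ` UNIV"
    by (auto simp: Basis_vec_def)
  have inj: "inj (\<lambda>l :: 'n. axis l (1 :: real))"
    by (rule injI) (simp add: axis_eq_axis)
  show "(\<Prod>b\<in>Basis. g b (h b)) = (\<Prod>l\<in>UNIV. f l (h (axis l 1)))"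
    unfolding B prod.reindex[OF inj] by (simp add: g)
qed

lemma lborel_prod_vec:
  fixes f :: "'n::finite \<Rightarrow> real \<Rightarrow> complex"
  assumes int: "\<And>l. integrable lborel (f l)"
  shows "integrable lborel (\<lambda>t :: real ^ 'n. \<Prod>l\<in>UNIV. f l (t $ l))"
    and "(\<integral>t. (\<Prod>l\<in>UNIV. f l (t $ l)) \<partial>(lborel :: (real ^ 'n) measure)) = (\<Prod>l\<in>UNIV. \<integral>s. f l s \<partial>lborel)"
proof -
  interpret product_sigma_finite "\<lambda>_ :: real ^ 'n. lborel :: real measure" ..
  define g where "g b = f (THE l. axis l 1 = b)" for b :: "real ^ 'n"
  have gint: "integrable lborel (g b)" for b unfolding g_def by (rule int)
  note [measurable] = borel_measurable_integrable[OF int] borel_measurable_integrable[OF gint]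
  let ?P = "Pi\<^sub>M Basis (\<lambda>_ :: real ^ 'n. lborel :: real measure)"
  let ?e = "\<lambda>x. \<Sum>b\<in>Basis. x b *\<^sub>R b :: real ^ 'n"
  have eq: "(\<Prod>l\<in>UNIV. f l (?e x $ l)) = (\<Prod>b\<in>Basis. g b (x b))" for x
  proof -
    have "?e x $ l = x (axis l 1)" for l
    proof -
      have "?e x $ l = ?e x \<bullet> axis l 1" by (simp add: inner_axis)
      also have "\<dots> = x (axis l 1)"
        by (subst inner_sum_left_Basis) (auto simp: axis_in_Basis_iff)
      finally show ?thesis .
    qed
    then show ?thesis using prod_Basis_vec[of f x] by (simp add: g_def)
  qed
  have [measurable]: "?e \<in> borel_measurable ?P" by measurable
  have [measurable]: "(\<lambda>t :: real ^ 'n. \<Prod>l\<in>UNIV. f l (t $ l)) \<in> borel_measurable borel"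
    by measurable
  have "integrable ?P (\<lambda>x. \<Prod>l\<in>UNIV. f l (?e x $ l))"
    unfolding eq by (rule product_integrable_prod) (auto simp: gint)
  then show "integrable lborel (\<lambda>t :: real ^ 'n. \<Prod>l\<in>UNIV. f l (t $ l))"
    by (subst lborel_eq, subst integrable_distr_eq) simp_all
  have "(\<integral>t. (\<Prod>l\<in>UNIV. f l (t $ l)) \<partial>(lborel :: (real ^ 'n) measure)) =
      (\<integral>x. (\<Prod>b\<in>Basis. g b (x b)) \<partial>?P)"
    unfolding eq[symmetric] by (subst lborel_eq, subst integral_distr) simp_all
  also have "\<dots> = (\<Prod>b\<in>Basis. \<integral>s. g b s \<partial>lborel)"
    by (rule product_integral_prod) (auto simp: gint)
  also have "\<dots> = (\<Prod>l\<in>UNIV. \<integral>s. f l s \<partial>lborel)"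
    using prod_Basis_vec[of "\<lambda>l _. \<integral>s. f l s \<partial>lborel" undefined] by (simp add: g_def)
  finally show "(\<integral>t. (\<Prod>l\<in>UNIV. f l (t $ l)) \<partial>(lborel :: (real ^ 'n) measure)) = (\<Prod>l\<in>UNIV. \<integral>s. f l s \<partial>lborel)" .
qed

text \<open>The Fourier multiplier that replaces the formal factor \<open>1 / (- \<i> s)\<close>: damped by \<open>\<epsilon>\<close> and cut off
  outside \<open>[-T, T]\<close> by the rescaled Parzen window.\<close>

definition cutoff :: "real \<Rightarrow> real \<Rightarrow> real \<Rightarrow> complex" where
  "cutoff T \<epsilon> s = of_real (parzen (s / T)) / (of_real (T * \<epsilon>) - \<i> * of_real s)"

text \<open>The last bound is the crucial one: it does not involve \<open>\<epsilon>\<close>.\<close>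

lemma cutoff_bound:
  assumes "T > 0" "\<epsilon> > 0"
  shows "\<bar>s\<bar> > T \<Longrightarrow> cutoff T \<epsilon> s = 0"
    and "cmod (cutoff T \<epsilon> s) \<le> 1 / (T * \<epsilon>)"
    and "s \<noteq> 0 \<Longrightarrow> cmod (cutoff T \<epsilon> s) \<le> 1 / \<bar>s\<bar>"
proof -
  let ?d = "complex_of_real (T * \<epsilon>) - \<i> * of_real s"
  have d1: "T * \<epsilon> \<le> cmod ?d" using complex_Re_le_cmod[of ?d] by simp
  have d2: "\<bar>s\<bar> \<le> cmod ?d" using abs_Im_le_cmod[of ?d] by simp
  have n: "cmod (cutoff T \<epsilon> s) = \<bar>parzen (s / T)\<bar> / cmod ?d"
    unfolding cutoff_def norm_divide by simp
  show "cmod (cutoff T \<epsilon> s) \<le> 1 / (T * \<epsilon>)"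
    unfolding n using d1 assms by (intro frac_le abs_parzen_le) auto
  show "cmod (cutoff T \<epsilon> s) \<le> 1 / \<bar>s\<bar>" if "s \<noteq> 0"
    unfolding n using d2 that by (intro frac_le abs_parzen_le) auto
  show "cutoff T \<epsilon> s = 0" if "\<bar>s\<bar> > T"
    using that assms by (simp add: cutoff_def parzen_eq_0)
qed

lemma measurable_cutoff [measurable]: "cutoff T \<epsilon> \<in> borel_measurable borel"
  unfolding cutoff_def by measurable

lemma integrable_cutoff_mult:
  assumes "T > 0" "\<epsilon> > 0" and [measurable]: "g \<in> borel_measurable borel" and g: "\<And>s. cmod (g s) \<le> 1"
  shows "integrable lborel (\<lambda>s. cutoff T \<epsilon> s * g s)"
proof (rule integrableI_bounded_set[where A = "{-T..T}" and B = "1 / (T * \<epsilon>)"])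
  show "AE s in lborel. s \<in> {-T..T} \<longrightarrow> cmod (cutoff T \<epsilon> s * g s) \<le> 1 / (T * \<epsilon>)"
  proof (rule AE_I2, rule impI)
    fix s :: real
    have "cmod (cutoff T \<epsilon> s * g s) \<le> 1 / (T * \<epsilon>) * 1"
      unfolding norm_mult using cutoff_bound(2)[OF assms(1,2)] g assms(1,2) by (intro mult_mono) auto
    then show "cmod (cutoff T \<epsilon> s * g s) \<le> 1 / (T * \<epsilon>)" by simp
  qed
qed (use assms cutoff_bound(1)[OF assms(1,2)] in \<open>auto simp: abs_if\<close>)

lemma damped_cdf_cutoff:
  assumes T: "T > 0" and \<epsilon>: "\<epsilon> > 0"
  shows "of_real (2 * pi * damped_cdf \<epsilon> (T * v)) =
    (\<integral>s. cutoff T \<epsilon> s * exp (- (\<i> * of_real (v * s))) \<partial>lborel)"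
proof -
  let ?g = "\<lambda>t. complex_of_real (parzen t) * (exp (- (\<i> * of_real (T * v * t))) / (of_real \<epsilon> - \<i> * of_real t))"
  have "of_real (2 * pi * damped_cdf \<epsilon> (T * v)) = (\<integral>t. ?g t \<partial>lborel)"
    by (rule damped_cdf_fourier[OF \<epsilon>])
  also have "\<dots> = \<bar>1 / T\<bar> *\<^sub>R (\<integral>s. ?g (0 + 1 / T * s) \<partial>lborel)"
    using T by (intro lborel_integral_real_affine) auto
  also have "\<dots> = (\<integral>s. of_real (1 / T) * ?g (0 + 1 / T * s) \<partial>lborel)"
    using T by (simp only: integral_mult_right_zero scaleR_conv_of_real) simp
  also have "\<dots> = (\<integral>s. cutoff T \<epsilon> s * exp (- (\<i> * of_real (v * s))) \<partial>lborel)"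
  proof (rule Bochner_Integration.integral_cong[OF refl])
    fix s :: real
    have a: "T * v * (0 + 1 / T * s) = v * s" using T by simp
    have "of_real T * (complex_of_real \<epsilon> - \<i> * of_real (0 + 1 / T * s)) = of_real (T * \<epsilon>) - \<i> * of_real s"
      using T by (simp add: algebra_simps)
    then have b: "of_real (1 / T) / (complex_of_real \<epsilon> - \<i> * of_real (0 + 1 / T * s)) = 1 / (of_real (T * \<epsilon>) - \<i> * of_real s)"
      by (metis divide_divide_eq_left of_real_1 of_real_divide)
    have c: "0 + 1 / T * s = s / T" by simp
    have "of_real (1 / T) * ?g (0 + 1 / T * s) = of_real (parzen (0 + 1 / T * s)) *
      (of_real (1 / T) / (complex_of_real \<epsilon> - \<i> * of_real (0 + 1 / T * s))) * exp (- (\<i> * of_real (T * v * (0 + 1 / T * s))))"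
      by (simp only: times_divide_eq_right times_divide_eq_left mult_ac)
    also have "\<dots> = cutoff T \<epsilon> s * exp (- (\<i> * of_real (v * s)))"
      unfolding a b by (simp add: cutoff_def)
    finally show "of_real (1 / T) * ?g (0 + 1 / T * s) = cutoff T \<epsilon> s * exp (- (\<i> * of_real (v * s)))" .
  qed
  finally show ?thesis .
qed

text \<open>For fixed \<open>\<omega>\<close> the product over the coordinates is a Fourier integral over \<open>\<real>\<^sup>m\<close>;
  taking the expectation under the integral sign turns \<open>e ^ (\<i> \<langle>t, Z\<rangle>)\<close> into the
  characteristic function.\<close>

lemma damped_box_fourier:
  fixes Z :: "'a \<Rightarrow> real ^ 'n" and z :: "real ^ 'n"
  assumes M: "prob_space M" and Z [measurable]: "Z \<in> borel_measurable M" and T: "T > 0" and \<epsilon>: "\<epsilon> > 0"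
  defines "f \<equiv> \<lambda>t. (\<Prod>l\<in>UNIV. cutoff T \<epsilon> (t $ l)) * exp (- (\<i> * of_real (t \<bullet> z))) * char_fun M Z t"
  shows "integrable lborel f"
    and "of_real ((2 * pi) ^ CARD('n) * (\<integral>\<omega>. (\<Prod>l\<in>UNIV. damped_cdf \<epsilon> (T * (z $ l - Z \<omega> $ l))) \<partial>M)) = (\<integral>t. f t \<partial>lborel)"
proof -
  interpret M: prob_space M by (rule M)
  interpret pair_sigma_finite "lborel :: (real ^ 'n) measure" M ..
  define h where "h t \<omega> = (\<Prod>l\<in>UNIV. cutoff T \<epsilon> (t $ l)) * exp (- (\<i> * of_real (t \<bullet> z))) * exp (\<i> * of_real (t \<bullet> Z \<omega>))"
    for t :: "real ^ 'n" and \<omega>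
  have nh: "cmod (h t \<omega>) = cmod (\<Prod>l\<in>UNIV. cutoff T \<epsilon> (t $ l))" for t \<omega>
    by (simp add: h_def norm_mult)
  have ic: "integrable lborel (\<lambda>t :: real ^ 'n. \<Prod>l\<in>UNIV. cutoff T \<epsilon> (t $ l))"
    by (rule lborel_prod_vec) (use integrable_cutoff_mult[OF T \<epsilon>, of "\<lambda>_. 1"] in simp)
  have int: "integrable (lborel \<Otimes>\<^sub>M M) (case_prod h)"
  proof (rule Fubini_integrable)
    show "case_prod h \<in> borel_measurable (lborel \<Otimes>\<^sub>M M)"
      unfolding h_def by measurable
    show "integrable lborel (\<lambda>t. \<integral>\<omega>. norm (case (t, \<omega>) of (t, \<omega>) \<Rightarrow> h t \<omega>) \<partial>M)"
      using ic by (simp add: nh M.prob_space integrable_norm)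
    show "AE t in lborel. integrable M (\<lambda>\<omega>. case (t, \<omega>) of (t, \<omega>) \<Rightarrow> h t \<omega>)"
    proof (rule AE_I2)
      fix t :: "real ^ 'n"
      have "(\<lambda>\<omega>. h t \<omega>) \<in> borel_measurable M" unfolding h_def by measurable
      then show "integrable M (\<lambda>\<omega>. case (t, \<omega>) of (t, \<omega>) \<Rightarrow> h t \<omega>)"
        by (auto intro!: M.integrable_const_bound[where B = "cmod (\<Prod>l\<in>UNIV. cutoff T \<epsilon> (t $ l))"] simp: nh)
    qed
  qed
  have f: "(\<integral>\<omega>. h t \<omega> \<partial>M) = f t" for t
    by (simp add: h_def f_def char_fun_def)
  show "integrable lborel f"
    using integrable_fst[OF int] by (simp add: f)
  have "(\<integral>t. f t \<partial>lborel) = (\<integral>\<omega>. (\<integral>t. h t \<omega> \<partial>lborel) \<partial>M)"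
    unfolding f[symmetric] by (rule Fubini_integral[OF int, symmetric])
  also have "\<dots> = (\<integral>\<omega>. of_real ((2 * pi) ^ CARD('n) * (\<Prod>l\<in>UNIV. damped_cdf \<epsilon> (T * (z $ l - Z \<omega> $ l)))) \<partial>M)"
  proof (rule Bochner_Integration.integral_cong[OF refl])
    fix \<omega>
    have "h t \<omega> = (\<Prod>l\<in>UNIV. cutoff T \<epsilon> (t $ l) * exp (- (\<i> * of_real ((z $ l - Z \<omega> $ l) * t $ l))))" for t
    proof -
      have "exp (- (\<i> * of_real (t \<bullet> z))) * exp (\<i> * of_real (t \<bullet> Z \<omega>)) =
          exp (\<Sum>l\<in>UNIV. - (\<i> * of_real ((z $ l - Z \<omega> $ l) * t $ l)))"
        by (simp add: exp_add[symmetric] inner_vec_def sum_distrib_left sum_negf sum_subtractf algebra_simps)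
      then show ?thesis unfolding h_def prod.distrib exp_sum[OF finite] by (simp add: mult.assoc)
    qed
    then have "(\<integral>t. h t \<omega> \<partial>lborel) = (\<Prod>l\<in>UNIV. \<integral>s. cutoff T \<epsilon> s * exp (- (\<i> * of_real ((z $ l - Z \<omega> $ l) * s))) \<partial>lborel)"
      using lborel_prod_vec(2)[of "\<lambda>l s. cutoff T \<epsilon> s * exp (- (\<i> * of_real ((z $ l - Z \<omega> $ l) * s)))"]
        integrable_cutoff_mult[OF T \<epsilon>] by simp
    also have "\<dots> = (\<Prod>l\<in>UNIV. of_real (2 * pi * damped_cdf \<epsilon> (T * (z $ l - Z \<omega> $ l))))"
      by (simp only: damped_cdf_cutoff[OF T \<epsilon>])
    also have "\<dots> = of_real ((2 * pi) ^ CARD('n) * (\<Prod>l\<in>UNIV. damped_cdf \<epsilon> (T * (z $ l - Z \<omega> $ l))))"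
      by (simp add: prod.distrib)
    finally show "(\<integral>t. h t \<omega> \<partial>lborel) = of_real ((2 * pi) ^ CARD('n) * (\<Prod>l\<in>UNIV. damped_cdf \<epsilon> (T * (z $ l - Z \<omega> $ l))))" .
  qed
  finally show "of_real ((2 * pi) ^ CARD('n) * (\<integral>\<omega>. (\<Prod>l\<in>UNIV. damped_cdf \<epsilon> (T * (z $ l - Z \<omega> $ l))) \<partial>M)) = (\<integral>t. f t \<partial>lborel)"
    by (simp only: integral_complex_of_real integral_mult_right_zero)
qed

section \<open>Independent copies and the signed measure behind \<open>\<Lambda>\<close>\<close>

text \<open>Each block \<open>J\<close> of \<open>\<alpha>\<close> has its own independent copy of \<open>X\<close>, and coordinate \<open>l\<close> is read off from the copy
  that belongs to the block of \<open>l\<close>.\<close>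

definition blockwise_copy :: "'k set set \<Rightarrow> ('a \<Rightarrow> real ^ 'k) \<Rightarrow> ('k set \<Rightarrow> 'a) \<Rightarrow> real ^ 'k" where
  "blockwise_copy \<alpha> X \<omega> = (\<chi> l. X (\<omega> (THE J. J \<in> \<alpha> \<and> l \<in> J)) $ l)"

lemma the_block:
  assumes "partition_on A \<alpha>" "J \<in> \<alpha>" "l \<in> J"
  shows "(THE J. J \<in> \<alpha> \<and> l \<in> J) = J"
proof (rule the_equality)
  show "K = J" if "K \<in> \<alpha> \<and> l \<in> K" for K
    using that assms partition_onD2[OF assms(1)] by (meson disjnt_iff pairwiseD)
qed (use assms in auto)

lemma measurable_blockwise_copy [measurable]:
  fixes X :: "'a \<Rightarrow> real ^ 'n"
  assumes [measurable]: "X \<in> borel_measurable M" and \<alpha>: "partition_on UNIV \<alpha>"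
  shows "blockwise_copy \<alpha> X \<in> borel_measurable (Pi\<^sub>M \<alpha> (\<lambda>_. M))"
proof (rule borel_measurable_euclidean_space[THEN iffD2], rule ballI)
  fix b :: "real ^ 'n" assume "b \<in> Basis"
  then obtain l where b: "b = axis l 1" by (auto simp: Basis_vec_def)
  obtain J where J: "J \<in> \<alpha>" "l \<in> J" using partition_onD1[OF \<alpha>] by blast
  have [measurable]: "(\<lambda>\<omega>. \<omega> J) \<in> Pi\<^sub>M \<alpha> (\<lambda>_. M) \<rightarrow>\<^sub>M M"
    by (rule measurable_component_singleton[OF J(1)])
  have "(\<lambda>\<omega>. X (\<omega> J) $ l) \<in> borel_measurable (Pi\<^sub>M \<alpha> (\<lambda>_. M))" by measurable
  then show "(\<lambda>\<omega>. blockwise_copy \<alpha> X \<omega> \<bullet> b) \<in> borel_measurable (Pi\<^sub>M \<alpha> (\<lambda>_. M))"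
    using the_block[OF \<alpha> J] by (simp add: b inner_axis blockwise_copy_def)
qed

text \<open>Both the characteristic function and the distribution function of the assembled vector are
  expectations of products over the coordinates, so that independence of the blocks is needed in this
  form only.\<close>

lemma integral_blockwise_copy:
  fixes X :: "'a \<Rightarrow> real ^ 'n" and g :: "'n \<Rightarrow> real \<Rightarrow> complex"
  assumes M: "prob_space M" and [measurable]: "X \<in> borel_measurable M" and \<alpha>: "partition_on UNIV \<alpha>"
    and [measurable]: "\<And>l. g l \<in> borel_measurable borel" and g: "\<And>l x. cmod (g l x) \<le> 1"
  shows "(\<integral>\<omega>. (\<Prod>l\<in>UNIV. g l (blockwise_copy \<alpha> X \<omega> $ l)) \<partial>Pi\<^sub>M \<alpha> (\<lambda>_. M)) =
    (\<Prod>J\<in>\<alpha>. \<integral>\<omega>. (\<Prod>l\<in>J. g l (X \<omega> $ l)) \<partial>M)"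
proof -
  interpret M: prob_space M by (rule M)
  interpret product_sigma_finite "\<lambda>_ :: 'n set. M" ..
  have split: "(\<Prod>l\<in>UNIV. f l) = (\<Prod>J\<in>\<alpha>. \<Prod>l\<in>J. f l)" for f :: "'n \<Rightarrow> complex"
    using partition_onD1[OF \<alpha>] partition_onD2[OF \<alpha>]
      prod.Union_disjoint[of \<alpha> f] by (simp add: pairwise_def disjnt_def)
  have "(\<integral>\<omega>. (\<Prod>l\<in>UNIV. g l (blockwise_copy \<alpha> X \<omega> $ l)) \<partial>Pi\<^sub>M \<alpha> (\<lambda>_. M)) =
      (\<integral>\<omega>. (\<Prod>J\<in>\<alpha>. (\<lambda>\<omega>'. \<Prod>l\<in>J. g l (X \<omega>' $ l)) (\<omega> J)) \<partial>Pi\<^sub>M \<alpha> (\<lambda>_. M))"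
    unfolding split blockwise_copy_def by (simp add: the_block[OF \<alpha>] cong: prod.cong)
  also have "\<dots> = (\<Prod>J\<in>\<alpha>. \<integral>\<omega>. (\<Prod>l\<in>J. g l (X \<omega> $ l)) \<partial>M)"
  proof (rule product_integral_prod)
    show "integrable M (\<lambda>\<omega>. \<Prod>l\<in>J. g l (X \<omega> $ l))" for J
      using g by (intro M.integrable_const_bound[where B = 1] AE_I2)
        (auto simp: prod_norm[symmetric] intro!: prod_le_1)
  qed simp
  finally show ?thesis .
qed

lemma prob_space_PiM_const: "prob_space M \<Longrightarrow> prob_space (Pi\<^sub>M I (\<lambda>_. M))"
  by (rule prob_space_PiM)

lemma char_fun_blockwise_copy:
  fixes X :: "'a \<Rightarrow> real ^ 'n"
  assumes M: "prob_space M" and X: "X \<in> borel_measurable M" and \<alpha>: "partition_on UNIV \<alpha>"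
  shows "char_fun (Pi\<^sub>M \<alpha> (\<lambda>_. M)) (blockwise_copy \<alpha> X) t = (\<Prod>J\<in>\<alpha>. char_fun M X (psi J t))"
proof -
  have e: "exp (\<i> * complex_of_real (psi J t \<bullet> y)) = (\<Prod>l\<in>J. exp (\<i> * complex_of_real (t $ l * y $ l)))" for J y
  proof -
    have "psi J t \<bullet> y = (\<Sum>l\<in>UNIV. if l \<in> J then t $ l * y $ l else 0)"
      by (auto simp: psi_def inner_vec_def intro!: sum.cong)
    also have "\<dots> = (\<Sum>l\<in>J. t $ l * y $ l)"
      by (simp add: sum.If_cases)
    finally show ?thesis
      by (simp add: exp_sum[symmetric] sum_distrib_left)
  qed
  have U: "psi UNIV t = t" by (simp add: psi_def vec_eq_iff)
  have "char_fun (Pi\<^sub>M \<alpha> (\<lambda>_. M)) (blockwise_copy \<alpha> X) t =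
    (\<integral>\<omega>. (\<Prod>l\<in>UNIV. exp (\<i> * complex_of_real (t $ l * blockwise_copy \<alpha> X \<omega> $ l))) \<partial>Pi\<^sub>M \<alpha> (\<lambda>_. M))"
    unfolding char_fun_def e[of UNIV, unfolded U] ..
  also have "\<dots> = (\<Prod>J\<in>\<alpha>. \<integral>\<omega>. (\<Prod>l\<in>J. exp (\<i> * complex_of_real (t $ l * X \<omega> $ l))) \<partial>M)"
    by (rule integral_blockwise_copy[OF M X \<alpha>]) auto
  finally show ?thesis unfolding char_fun_def e .
qed

lemma joint_cdf_proj:
  "joint_cdf M (proj J X) (\<lambda>j\<in>J. z $ j) = measure M {\<omega> \<in> space M. \<forall>j\<in>J. X \<omega> $ j \<le> z $ j}"
  unfolding joint_cdf_def proj_def by (rule arg_cong[where f = "measure M"]) (auto simp: le_fun_def)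

lemma joint_cdf_vec: "joint_cdf M X z = measure M {\<omega> \<in> space M. \<forall>j. X \<omega> $ j \<le> z $ j}"
  unfolding joint_cdf_def less_eq_vec_def ..

lemma joint_cdf_blockwise_copy:
  fixes X :: "'a \<Rightarrow> real ^ 'n"
  assumes M: "prob_space M" and X [measurable]: "X \<in> borel_measurable M" and \<alpha>: "partition_on UNIV \<alpha>"
  shows "joint_cdf (Pi\<^sub>M \<alpha> (\<lambda>_. M)) (blockwise_copy \<alpha> X) z =
    (\<Prod>J\<in>\<alpha>. joint_cdf M (proj J X) (\<lambda>j\<in>J. z $ j))"
proof -
  have cdf: "(\<integral>\<omega>. (\<Prod>l\<in>J. complex_of_real (indicator {..z $ l} (Z \<omega> $ l))) \<partial>P) =
      of_real (measure P {\<omega> \<in> space P. \<forall>l\<in>J. Z \<omega> $ l \<le> z $ l})"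
    if [measurable]: "Z \<in> borel_measurable P" for P :: "'c measure" and Z J
  proof -
    have "(\<integral>\<omega>. (\<Prod>l\<in>J. complex_of_real (indicator {..z $ l} (Z \<omega> $ l))) \<partial>P) =
        (\<integral>\<omega>. complex_of_real (indicator {\<omega> \<in> space P. \<forall>l\<in>J. Z \<omega> $ l \<le> z $ l} \<omega>) \<partial>P)"
    proof (rule Bochner_Integration.integral_cong[OF refl])
      fix \<omega> assume "\<omega> \<in> space P"
      then show "(\<Prod>l\<in>J. complex_of_real (indicator {..z $ l} (Z \<omega> $ l))) =
          complex_of_real (indicator {\<omega> \<in> space P. \<forall>l\<in>J. Z \<omega> $ l \<le> z $ l} \<omega>)"
        by (auto simp: indicator_def intro!: prod_zero prod.neutral)
    qed
    also have "\<dots> = of_real (measure P {\<omega> \<in> space P. \<forall>l\<in>J. Z \<omega> $ l \<le> z $ l})"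
      unfolding integral_complex_of_real by (simp add: Int_absorb2 subset_iff)
    finally show ?thesis .
  qed
  have "complex_of_real (joint_cdf (Pi\<^sub>M \<alpha> (\<lambda>_. M)) (blockwise_copy \<alpha> X) z) =
    (\<integral>\<omega>. (\<Prod>l\<in>UNIV. complex_of_real (indicator {..z $ l} (blockwise_copy \<alpha> X \<omega> $ l))) \<partial>Pi\<^sub>M \<alpha> (\<lambda>_. M))"
    unfolding joint_cdf_vec using cdf[OF measurable_blockwise_copy[OF X \<alpha>], of UNIV] by simp
  also have "\<dots> = (\<Prod>J\<in>\<alpha>. \<integral>\<omega>. (\<Prod>l\<in>J. complex_of_real (indicator {..z $ l} (X \<omega> $ l))) \<partial>M)"
    by (rule integral_blockwise_copy[OF M X \<alpha>]) (auto simp: indicator_def)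
  also have "\<dots> = (\<Prod>J\<in>\<alpha>. of_real (joint_cdf M (proj J X) (\<lambda>j\<in>J. z $ j)))"
    unfolding joint_cdf_proj by (intro prod.cong refl cdf X)
  finally show ?thesis unfolding of_real_prod[symmetric] of_real_eq_iff .
qed

abbreviation jackson_product :: "('n \<Rightarrow> real) measure" where
  "jackson_product \<equiv> Pi\<^sub>M UNIV (\<lambda>_. jackson_measure)"

text \<open>Averaging the distribution function of \<open>Z\<close> over shifts by \<open>Q / T\<close> is the same as
  replacing the indicator of an orthant by a product of distribution functions of the kernel. The latter are what
  the damped functions converge to.\<close>

lemma jackson_convolution:
  fixes Z :: "'a \<Rightarrow> real ^ 'n" and z :: "real ^ 'n"
  assumes M: "prob_space M" and Z [measurable]: "Z \<in> borel_measurable M" and T: "T > 0"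
  shows "integrable jackson_product (\<lambda>q. joint_cdf M Z (z - (\<chi> l. q l / T)))"
    and "(\<integral>q. joint_cdf M Z (z - (\<chi> l. q l / T)) \<partial>jackson_product) =
      (\<integral>\<omega>. (\<Prod>l\<in>UNIV. measure jackson_measure {..T * (z $ l - Z \<omega> $ l)}) \<partial>M)"
proof -
  interpret M: prob_space M by (rule M)
  interpret K: prob_space jackson_measure by (rule prob_space_jackson_measure)
  interpret KK: product_sigma_finite "\<lambda>_ :: 'n. jackson_measure" ..
  interpret Q: prob_space "jackson_product :: ('n \<Rightarrow> real) measure"
    by (rule prob_space_PiM_const[OF prob_space_jackson_measure])
  interpret pair_sigma_finite "jackson_product :: ('n \<Rightarrow> real) measure" M ..
  interpret pair_prob_space "jackson_product :: ('n \<Rightarrow> real) measure" M ..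
  define f where "f q \<omega> = (\<Prod>l\<in>UNIV. indicator {..T * (z $ l - Z \<omega> $ l)} (q l) :: real)" for q :: "'n \<Rightarrow> real" and \<omega>
  have f: "f q \<omega> = (if \<forall>l. q l \<le> T * (z $ l - Z \<omega> $ l) then 1 else 0)" for q \<omega>
    by (auto simp: f_def indicator_def intro!: prod_zero exI)
  have [measurable]: "(\<lambda>x. fst x l) \<in> borel_measurable (jackson_product \<Otimes>\<^sub>M M)" for l :: 'n
  proof -
    have "(\<lambda>q. q l) \<in> jackson_product \<rightarrow>\<^sub>M jackson_measure" by measurable
    then have "(\<lambda>q. q l) \<in> borel_measurable jackson_product" by (simp cong: measurable_cong_sets)
    then show ?thesis by measurable
  qed
  have "case_prod f \<in> borel_measurable (jackson_product \<Otimes>\<^sub>M M)"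
    unfolding f split_beta' by measurable
  then have int: "integrable (jackson_product \<Otimes>\<^sub>M M) (case_prod f)"
    by (intro P.integrable_const_bound[where B = 1]) (auto simp: f)
  have F: "(\<integral>\<omega>. f q \<omega> \<partial>M) = joint_cdf M Z (z - (\<chi> l. q l / T))" for q
  proof -
    have "(\<integral>\<omega>. f q \<omega> \<partial>M) = (\<integral>\<omega>. indicator {\<omega> \<in> space M. \<forall>l. Z \<omega> $ l \<le> z $ l - q l / T} \<omega> \<partial>M)"
      using T by (intro Bochner_Integration.integral_cong refl) (auto simp: f indicator_def field_simps)
    also have "\<dots> = joint_cdf M Z (z - (\<chi> l. q l / T))"
      by (simp add: joint_cdf_vec Int_absorb2 subset_iff)
    finally show ?thesis .
  qed
  show "integrable jackson_product (\<lambda>q. joint_cdf M Z (z - (\<chi> l. q l / T)))"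
    using integrable_fst[OF int] by (simp add: F)
  have "(\<integral>q. joint_cdf M Z (z - (\<chi> l. q l / T)) \<partial>jackson_product) = (\<integral>\<omega>. (\<integral>q. f q \<omega> \<partial>jackson_product) \<partial>M)"
    unfolding F[symmetric] by (rule Fubini_integral[OF int, symmetric])
  also have "\<dots> = (\<integral>\<omega>. (\<Prod>l\<in>UNIV. measure jackson_measure {..T * (z $ l - Z \<omega> $ l)}) \<partial>M)"
  proof (rule Bochner_Integration.integral_cong[OF refl])
    fix \<omega>
    show "(\<integral>q. f q \<omega> \<partial>jackson_product) = (\<Prod>l\<in>UNIV. measure jackson_measure {..T * (z $ l - Z \<omega> $ l)})"
      unfolding f_def
      by (subst KK.product_integral_prod) (auto intro!: integrable_real_indicator simp: K.emeasure_finite less_top[symmetric])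
  qed
  finally show "(\<integral>q. joint_cdf M Z (z - (\<chi> l. q l / T)) \<partial>jackson_product) =
      (\<integral>\<omega>. (\<Prod>l\<in>UNIV. measure jackson_measure {..T * (z $ l - Z \<omega> $ l)}) \<partial>M)" .
qed

lemma damped_box_tendsto:
  fixes Z :: "'a \<Rightarrow> real ^ 'n" and z :: "real ^ 'n"
  assumes M: "prob_space M" and Z [measurable]: "Z \<in> borel_measurable M" and T: "T > 0"
  shows "(\<lambda>n. \<integral>\<omega>. (\<Prod>l\<in>UNIV. damped_cdf (inverse (real (Suc n))) (T * (z $ l - Z \<omega> $ l))) \<partial>M)
    \<longlonglongrightarrow> (\<integral>q. joint_cdf M Z (z - (\<chi> l. q l / T)) \<partial>jackson_product)"
proof -
  interpret M: prob_space M by (rule M)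
  have lim: "(\<lambda>n. \<Prod>l\<in>UNIV. damped_cdf (inverse (real (Suc n))) (T * (z $ l - Z \<omega> $ l)))
      \<longlonglongrightarrow> (\<Prod>l\<in>UNIV. measure jackson_measure {..T * (z $ l - Z \<omega> $ l)})" for \<omega>
    by (intro tendsto_prod damped_cdf_tendsto_cdf)
  show ?thesis
    unfolding jackson_convolution(2)[OF assms]
  proof (rule integral_dominated_convergence[where w = "\<lambda>_. 1"])
    show m: "(\<lambda>\<omega>. \<Prod>l\<in>UNIV. damped_cdf (inverse (real (Suc n))) (T * (z $ l - Z \<omega> $ l))) \<in> borel_measurable M" for n
      by measurable
    show "(\<lambda>\<omega>. \<Prod>l\<in>UNIV. measure jackson_measure {..T * (z $ l - Z \<omega> $ l)}) \<in> borel_measurable M"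
      by (rule borel_measurable_LIMSEQ_real[OF lim m])
    show "AE \<omega> in M. norm (\<Prod>l\<in>UNIV. damped_cdf (inverse (real (Suc n))) (T * (z $ l - Z \<omega> $ l))) \<le> 1" for n
      by (rule AE_I2) (auto simp: abs_prod damped_cdf_nonneg intro!: prod_le_1 damped_cdf_le_1)
  qed (use lim in simp_all)
qed

lemma AE_lborel_vec_nonzero: "AE t :: real ^ 'n in lborel. \<forall>l. t $ l \<noteq> 0"
proof -
  have "{t :: real ^ 'n. t $ l = 0} \<in> null_sets lborel" for l
  proof -
    have "{t :: real ^ 'n. t $ l = 0} \<in> null_sets lebesgue"
      using negligible_standard_hyperplane_cart[of l] by (simp add: negligible_iff_null_sets)
    moreover have "{t :: real ^ 'n. t $ l = 0} \<in> sets lborel" by measurable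
    ultimately show ?thesis by (simp add: null_sets_completion_iff)
  qed
  then have "AE t :: real ^ 'n in lborel. t $ l \<noteq> 0" for l
    by (rule AE_I'[where N = "{t. t $ l = 0}"]) auto
  then show ?thesis by (simp add: AE_all_countable)
qed

lemma infnorm_le_iff_vec: "infnorm (t :: real ^ 'n) \<le> T \<longleftrightarrow> (\<forall>l. \<bar>t $ l\<bar> \<le> T)"
proof
  show "\<forall>l. \<bar>t $ l\<bar> \<le> T" if "infnorm t \<le> T"
    using that component_le_infnorm_cart order_trans by blast
  show "infnorm t \<le> T" if "\<forall>l. \<bar>t $ l\<bar> \<le> T"
    unfolding infnorm_Max using that by (auto simp: Basis_vec_def inner_axis)
qed

text \<open>For every \<open>\<epsilon>\<close>, the combination with coefficients \<open>\<mu>\<^sub>\<alpha>\<close> of the damped expectations is a Fourier integral of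
  \<open>\<Lambda> (\<phi>\<^sub>X) - \<Lambda> (\<phi>\<^sub>Y)\<close>. Its absolute value is bounded independently of \<open>\<epsilon>\<close>, and the bound survives the
  limit on the left-hand side.\<close>

lemma Lambda_smoothing_bound:
  fixes X :: "'a \<Rightarrow> real ^ 'n" and Y :: "'b \<Rightarrow> real ^ 'n" and z :: "real ^ 'n"
  assumes M: "prob_space M" and X: "X \<in> borel_measurable M"
    and N: "prob_space N" and Y: "Y \<in> borel_measurable N" and T: "T > 0"
    and I: "Lambda_integral M X N Y T = ennreal r" "r \<ge> 0"
  defines "D \<equiv> \<lambda>\<alpha> z. joint_cdf (Pi\<^sub>M \<alpha> (\<lambda>_. M)) (blockwise_copy \<alpha> X) z
                    - joint_cdf (Pi\<^sub>M \<alpha> (\<lambda>_. N)) (blockwise_copy \<alpha> Y) z"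
  shows "cmod (\<Sum>\<alpha> | partition_on (UNIV :: 'n set) \<alpha>.
      mu \<alpha> * of_real (\<integral>q. D \<alpha> (z - (\<chi> l. q l / T)) \<partial>jackson_product)) \<le> 1 / (2 * pi) ^ CARD('n) * r"
proof -
  let ?P = "{\<alpha>. partition_on (UNIV :: 'n set) \<alpha>}"
  define eX where "eX \<alpha> \<epsilon> = (\<integral>\<omega>. (\<Prod>l\<in>UNIV. damped_cdf \<epsilon> (T * (z $ l - blockwise_copy \<alpha> X \<omega> $ l))) \<partial>Pi\<^sub>M \<alpha> (\<lambda>_. M))" for \<alpha> \<epsilon>
  define eY where "eY \<alpha> \<epsilon> = (\<integral>\<omega>. (\<Prod>l\<in>UNIV. damped_cdf \<epsilon> (T * (z $ l - blockwise_copy \<alpha> Y \<omega> $ l))) \<partial>Pi\<^sub>M \<alpha> (\<lambda>_. N))" for \<alpha> \<epsilon>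
  note PM = prob_space_PiM_const[OF M] and PN = prob_space_PiM_const[OF N]
  have bound: "cmod (\<Sum>\<alpha>\<in>?P. mu \<alpha> * of_real (eX \<alpha> \<epsilon> - eY \<alpha> \<epsilon>)) \<le> 1 / (2 * pi) ^ CARD('n) * r"
    if \<epsilon>: "\<epsilon> > 0" for \<epsilon>
  proof -
    define w where "w t = (\<Prod>l\<in>UNIV. cutoff T \<epsilon> (t $ l)) * exp (- (\<i> * of_real (t \<bullet> z)))" for t :: "real ^ 'n"
    define \<Delta> where "\<Delta> t = Lambda (char_fun M X) t - Lambda (char_fun N Y) t" for t
    have c: "(2 * pi) ^ CARD('n) > 0" by simp
    have fX: "integrable lborel (\<lambda>t. w t * (\<Prod>J\<in>\<alpha>. char_fun M X (psi J t)))"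
      "of_real ((2 * pi) ^ CARD('n) * eX \<alpha> \<epsilon>) = (\<integral>t. w t * (\<Prod>J\<in>\<alpha>. char_fun M X (psi J t)) \<partial>lborel)"
      if \<alpha>: "partition_on UNIV \<alpha>" for \<alpha>
      using damped_box_fourier[OF PM measurable_blockwise_copy[OF X \<alpha>] T \<epsilon>, of z]
      by (simp_all only: char_fun_blockwise_copy[OF M X \<alpha>] w_def eX_def)
    have fY: "integrable lborel (\<lambda>t. w t * (\<Prod>J\<in>\<alpha>. char_fun N Y (psi J t)))"
      "of_real ((2 * pi) ^ CARD('n) * eY \<alpha> \<epsilon>) = (\<integral>t. w t * (\<Prod>J\<in>\<alpha>. char_fun N Y (psi J t)) \<partial>lborel)"
      if \<alpha>: "partition_on UNIV \<alpha>" for \<alpha>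
      using damped_box_fourier[OF PN measurable_blockwise_copy[OF Y \<alpha>] T \<epsilon>, of z]
      by (simp_all only: char_fun_blockwise_copy[OF N Y \<alpha>] w_def eY_def)
    let ?f = "\<lambda>\<alpha> t. mu \<alpha> * (w t * (\<Prod>J\<in>\<alpha>. char_fun M X (psi J t)) - w t * (\<Prod>J\<in>\<alpha>. char_fun N Y (psi J t)))"
    have sum_f: "(\<Sum>\<alpha>\<in>?P. ?f \<alpha> t) = w t * \<Delta> t" for t
      by (simp add: \<Delta>_def Lambda_def sum_distrib_left sum_subtractf algebra_simps)
    have int: "integrable lborel (?f \<alpha>)" if "\<alpha> \<in> ?P" for \<alpha>
      using fX(1) fY(1) that by (intro integrable_mult_right Bochner_Integration.integrable_diff) auto
    have int\<Delta>: "integrable lborel (\<lambda>t. w t * \<Delta> t)"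
      unfolding sum_f[symmetric] by (intro Bochner_Integration.integrable_sum int)
    have "of_real ((2 * pi) ^ CARD('n)) * (\<Sum>\<alpha>\<in>?P. mu \<alpha> * of_real (eX \<alpha> \<epsilon> - eY \<alpha> \<epsilon>)) =
        (\<Sum>\<alpha>\<in>?P. mu \<alpha> * (of_real ((2 * pi) ^ CARD('n) * eX \<alpha> \<epsilon>) - of_real ((2 * pi) ^ CARD('n) * eY \<alpha> \<epsilon>)))"
      by (simp add: sum_distrib_left algebra_simps)
    also have "\<dots> = (\<Sum>\<alpha>\<in>?P. \<integral>t. ?f \<alpha> t \<partial>lborel)"
    proof (rule sum.cong[OF refl])
      fix \<alpha> assume "\<alpha> \<in> ?P"
      then have \<alpha>: "partition_on UNIV \<alpha>" by simp
      show "mu \<alpha> * (of_real ((2 * pi) ^ CARD('n) * eX \<alpha> \<epsilon>) - of_real ((2 * pi) ^ CARD('n) * eY \<alpha> \<epsilon>)) = (\<integral>t. ?f \<alpha> t \<partial>lborel)"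
        unfolding fX(2)[OF \<alpha>] fY(2)[OF \<alpha>] integral_mult_right_zero
        by (subst Bochner_Integration.integral_diff[OF fX(1)[OF \<alpha>] fY(1)[OF \<alpha>]]) (rule refl)
    qed
    also have "\<dots> = (\<integral>t. w t * \<Delta> t \<partial>lborel)"
      unfolding sum_f[symmetric] by (rule Bochner_Integration.integral_sum[symmetric]) (rule int)
    finally have eq: "of_real ((2 * pi) ^ CARD('n)) * (\<Sum>\<alpha>\<in>?P. mu \<alpha> * of_real (eX \<alpha> \<epsilon> - eY \<alpha> \<epsilon>)) = (\<integral>t. w t * \<Delta> t \<partial>lborel)" .
    have "ennreal (cmod (\<integral>t. w t * \<Delta> t \<partial>lborel)) \<le> (\<integral>\<^sup>+t. ennreal (cmod (w t * \<Delta> t)) \<partial>lborel)"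
      by (rule integral_norm_bound_ennreal[OF int\<Delta>])
    also have "\<dots> \<le> (\<integral>\<^sup>+t \<in> {t. infnorm t \<le> T}. ennreal (cmod (\<Delta> t / of_real (\<Prod>l\<in>UNIV. t $ l))) \<partial>lborel)"
    proof (rule nn_integral_mono_AE)
      show "AE t in lborel. ennreal (cmod (w t * \<Delta> t)) \<le>
        ennreal (cmod (\<Delta> t / of_real (\<Prod>l\<in>UNIV. t $ l))) * indicator {t. infnorm t \<le> T} t"
        using AE_lborel_vec_nonzero
      proof eventually_elim
        case (elim t)
        show ?case
        proof (cases "infnorm t \<le> T")
          case True
          have "cmod (w t) = (\<Prod>l\<in>UNIV. cmod (cutoff T \<epsilon> (t $ l)))"
            by (simp add: w_def norm_mult prod_norm[symmetric])
          also have "\<dots> \<le> (\<Prod>l\<in>UNIV. 1 / \<bar>t $ l\<bar>)"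
            using cutoff_bound(3)[OF T \<epsilon>] elim by (intro prod_mono) auto
          also have "\<dots> = 1 / cmod (of_real (\<Prod>l\<in>UNIV. t $ l))"
            by (simp add: prod_norm[symmetric] prod_dividef del: of_real_prod) (simp add: abs_prod)
          finally have "cmod (w t) * cmod (\<Delta> t) \<le> 1 / cmod (of_real (\<Prod>l\<in>UNIV. t $ l)) * cmod (\<Delta> t)"
            by (intro mult_right_mono) auto
          then have "cmod (w t * \<Delta> t) \<le> cmod (\<Delta> t / of_real (\<Prod>l\<in>UNIV. t $ l))"
            by (simp only: norm_mult norm_divide) simp
          then show ?thesis using True by (simp add: ennreal_leI)
        next
          case False
          then obtain l where "\<bar>t $ l\<bar> > T" by (auto simp: infnorm_le_iff_vec not_le)
          then have "cutoff T \<epsilon> (t $ l) = 0" by (rule cutoff_bound(1)[OF T \<epsilon>])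
          then have "w t = 0" by (auto simp: w_def intro!: prod_zero)
          then show ?thesis by simp
        qed
      qed
    qed
    also have "\<dots> = ennreal r" using I(1) by (simp add: Lambda_integral_def \<Delta>_def)
    finally have "cmod (\<integral>t. w t * \<Delta> t \<partial>lborel) \<le> r" using I(2) by (simp add: ennreal_le_iff)
    then have "(2 * pi) ^ CARD('n) * cmod (\<Sum>\<alpha>\<in>?P. mu \<alpha> * of_real (eX \<alpha> \<epsilon> - eY \<alpha> \<epsilon>)) \<le> r"
      unfolding eq[symmetric] norm_mult by (simp add: norm_power norm_mult)
    then show ?thesis using c by (simp add: field_simps)
  qed
  have "(\<lambda>n. \<Sum>\<alpha>\<in>?P. mu \<alpha> * of_real (eX \<alpha> (inverse (real (Suc n))) - eY \<alpha> (inverse (real (Suc n)))))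
    \<longlonglongrightarrow> (\<Sum>\<alpha>\<in>?P. mu \<alpha> * of_real (\<integral>q. D \<alpha> (z - (\<chi> l. q l / T)) \<partial>jackson_product))"
  proof (rule tendsto_sum)
    fix \<alpha> assume "\<alpha> \<in> ?P"
    then have \<alpha>: "partition_on UNIV \<alpha>" by simp
    note cX = measurable_blockwise_copy[OF X \<alpha>] and cY = measurable_blockwise_copy[OF Y \<alpha>]
    have "(\<integral>q. D \<alpha> (z - (\<chi> l. q l / T)) \<partial>jackson_product) =
        (\<integral>q. joint_cdf (Pi\<^sub>M \<alpha> (\<lambda>_. M)) (blockwise_copy \<alpha> X) (z - (\<chi> l. q l / T)) \<partial>jackson_product)
      - (\<integral>q. joint_cdf (Pi\<^sub>M \<alpha> (\<lambda>_. N)) (blockwise_copy \<alpha> Y) (z - (\<chi> l. q l / T)) \<partial>jackson_product)"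
      unfolding D_def
      by (rule Bochner_Integration.integral_diff[OF jackson_convolution(1)[OF PM cX T] jackson_convolution(1)[OF PN cY T]])
    moreover have "(\<lambda>n. mu \<alpha> * of_real (eX \<alpha> (inverse (real (Suc n))) - eY \<alpha> (inverse (real (Suc n)))))
      \<longlonglongrightarrow> mu \<alpha> * of_real ((\<integral>q. joint_cdf (Pi\<^sub>M \<alpha> (\<lambda>_. M)) (blockwise_copy \<alpha> X) (z - (\<chi> l. q l / T)) \<partial>jackson_product)
      - (\<integral>q. joint_cdf (Pi\<^sub>M \<alpha> (\<lambda>_. N)) (blockwise_copy \<alpha> Y) (z - (\<chi> l. q l / T)) \<partial>jackson_product))"
      unfolding eX_def eY_def
      by (intro tendsto_intros damped_box_tendsto[OF PM cX T] damped_box_tendsto[OF PN cY T])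
    ultimately show "(\<lambda>n. mu \<alpha> * of_real (eX \<alpha> (inverse (real (Suc n))) - eY \<alpha> (inverse (real (Suc n)))))
      \<longlonglongrightarrow> mu \<alpha> * of_real (\<integral>q. D \<alpha> (z - (\<chi> l. q l / T)) \<partial>jackson_product)"
      by simp
  qed
  from tendsto_norm[OF this] show ?thesis
    by (rule LIMSEQ_le_const2) (use bound in auto)
qed

section \<open>Smoothing inequality\<close>

text \<open>The definition of \<open>C1\<close> is the solution of \<open>1 - 32 / (\<pi> a ^ 3) = (3/4) powr (1 / m)\<close> for \<open>a\<close>, which gives each
  coordinate of \<open>Q\<close> the probability \<open>(3/4) powr (1 / m)\<close> of staying below \<open>a\<close>.\<close>

lemma C1_pos: "m > 0 \<Longrightarrow> C1 m > 0"
  and C1_cube: "m > 0 \<Longrightarrow> 32 / (pi * C1 m ^ 3) = 1 - (3 / 4) powr (1 / real m)"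
proof -
  assume m: "m > 0"
  have "(3 / 4 :: real) powr (1 / real m) < 1 powr (1 / real m)"
    using m by (intro powr_less_mono2) auto
  then have c: "1 - (3 / 4 :: real) powr (1 / real m) > 0" by simp
  then have pos: "32 / (pi * (1 - (3 / 4) powr (1 / real m))) > 0" by simp
  then show "C1 m > 0" by (simp add: C1_def)
  have "C1 m ^ 3 = 32 / (pi * (1 - (3 / 4) powr (1 / real m)))"
    unfolding C1_def using pos by (intro real_root_pow_pos) auto
  then show "32 / (pi * C1 m ^ 3) = 1 - (3 / 4) powr (1 / real m)" using c by simp
qed

lemma jackson_product_box:
  assumes \<sigma>: "\<bar>\<sigma>\<bar> = 1"
  shows "measure (jackson_product :: ('n::finite \<Rightarrow> real) measure) {q. \<forall>l. \<sigma> * q l \<le> C1 CARD('n)} \<ge> 3 / 4"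
proof -
  interpret K: prob_space jackson_measure by (rule prob_space_jackson_measure)
  interpret Q: finite_product_prob_space "\<lambda>_ :: 'n. jackson_measure" UNIV
    by standard simp
  let ?m = "CARD('n)" let ?a = "C1 ?m"
  have m: "?m > 0" by simp
  have "{q :: 'n \<Rightarrow> real. \<forall>l. \<sigma> * q l \<le> ?a} = (\<Pi>\<^sub>E l\<in>UNIV. {x. \<sigma> * x \<le> ?a})"
    by (auto simp: PiE_def extensional_def)
  then have "measure (jackson_product :: ('n \<Rightarrow> real) measure) {q. \<forall>l. \<sigma> * q l \<le> ?a} = 
      (\<Prod>l\<in>(UNIV :: 'n set). measure jackson_measure {x. \<sigma> * x \<le> ?a})"
    by (simp only:) (rule Q.prob_times, auto)
  also have "\<dots> \<ge> (\<Prod>l\<in>(UNIV :: 'n set). (3 / 4) powr (1 / real ?m))"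
    using jackson_tail[OF C1_pos[OF m] \<sigma>] C1_cube[OF m] by (intro prod_mono) auto
  also have "(\<Prod>l\<in>(UNIV :: 'n set). (3 / 4) powr (1 / real ?m)) = 3 / (4 :: real)"
    by (simp add: powr_power)
  finally show ?thesis .
qed

lemma jackson_product_abs:
  fixes l :: "'n::finite"
  shows "integrable (jackson_product :: ('n \<Rightarrow> real) measure) (\<lambda>q. \<bar>q l\<bar>)"
    and "(\<integral>q. \<bar>q l\<bar> \<partial>(jackson_product :: ('n \<Rightarrow> real) measure)) \<le> C2"
proof -
  let ?Q = "jackson_product :: ('n \<Rightarrow> real) measure"
  have d: "distr ?Q jackson_measure (\<lambda>q. q l) = jackson_measure"
    by (rule distr_PiM_component) (auto simp: prob_space_jackson_measure)
  have m: "(\<lambda>q. q l) \<in> measurable ?Q jackson_measure" by measurable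
  have a: "(\<lambda>x. \<bar>x\<bar>) \<in> borel_measurable jackson_measure" by measurable
  have "integrable (distr ?Q jackson_measure (\<lambda>q. q l)) (\<lambda>x. \<bar>x\<bar>)"
    unfolding d by (rule jackson_first_moment)
  then show "integrable ?Q (\<lambda>q. \<bar>q l\<bar>)"
    by (subst (asm) integrable_distr_eq[OF m a])
  have "(\<integral>q. \<bar>q l\<bar> \<partial>?Q) = (\<integral>x. \<bar>x\<bar> \<partial>distr ?Q jackson_measure (\<lambda>q. q l))"
    by (rule integral_distr[OF m a, symmetric])
  then show "(\<integral>q. \<bar>q l\<bar> \<partial>?Q) \<le> C2" unfolding d using jackson_first_moment(2) by simp
qed

text \<open>With probability at least \<open>3/4\<close> the point \<open>z - Q / T\<close> lies in the orthant with corner \<open>z\<^sub>0\<close> in direction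
  \<open>\<sigma>\<close>, where \<open>D\<close> is nearly as large as at \<open>z\<^sub>0\<close>; elsewhere \<open>D \<ge> - \<delta>\<close>. The case
  \<open>\<sigma> = -1\<close> is meant for \<open>F\<^sub>Y - F\<^sub>X\<close>.\<close>

lemma smoothing_lower_bound:
  fixes D :: "real ^ 'n \<Rightarrow> real" and A :: "'n \<Rightarrow> real"
  assumes T: "T > 0" and \<sigma>: "\<bar>\<sigma>\<bar> = 1" and A: "\<And>l. A l \<ge> 0"
    and \<delta>: "\<And>w. \<bar>D w\<bar> \<le> \<delta>"
    and D: "\<And>h. (\<And>l. h $ l \<ge> 0) \<Longrightarrow> D z0 - (\<Sum>l\<in>UNIV. A l * h $ l) \<le> D (z0 + \<sigma> *\<^sub>R h)"
  defines "z \<equiv> z0 + (\<chi> l. \<sigma> * C1 CARD('n) / T)"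
  assumes int: "integrable jackson_product (\<lambda>q. D (z - (\<chi> l. q l / T)))"
  shows "3 / 4 * D z0 - \<delta> / 4 - (\<Sum>l\<in>UNIV. A l) * (C1 CARD('n) + C2) / T
     \<le> (\<integral>q. D (z - (\<chi> l. q l / T)) \<partial>jackson_product)"
proof -
  interpret Q: prob_space "jackson_product :: ('n \<Rightarrow> real) measure"
    by (rule prob_space_PiM_const[OF prob_space_jackson_measure])
  let ?a = "C1 CARD('n)"
  have a: "?a > 0" by (rule C1_pos) simp
  define G where "G = {q :: 'n \<Rightarrow> real. \<forall>l. \<sigma> * q l \<le> ?a}"
  have ql: "(\<lambda>q :: 'n \<Rightarrow> real. q l) \<in> borel_measurable jackson_product" for l
  proof -
    have "(\<lambda>q :: 'n \<Rightarrow> real. q l) \<in> jackson_product \<rightarrow>\<^sub>M jackson_measure" by measurable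
    then show ?thesis by (simp cong: measurable_cong_sets)
  qed
  note [measurable] = ql
  have sp: "space (jackson_product :: ('n \<Rightarrow> real) measure) = UNIV" by (simp add: space_PiM)
  have "{q \<in> space (jackson_product :: ('n \<Rightarrow> real) measure). \<forall>l. \<sigma> * q l \<le> ?a} \<in> sets jackson_product"
    by measurable
  then have G [measurable]: "G \<in> sets jackson_product" by (simp add: G_def sp)
  \<comment> \<open>minorant of \<open>D (z - Q / T)\<close>: the value \<open>D z0\<close> on \<open>G\<close> and \<open>- \<delta>\<close> elsewhere, minus the total increment\<close>
  define L where "L q = indicator G q * (D z0 + \<delta>) - \<delta> - (\<Sum>l\<in>UNIV. A l * ((?a + \<bar>q l\<bar>) / T))" for q :: "'n \<Rightarrow> real"
  have \<delta>0: "D z0 + \<delta> \<ge> 0" using \<delta>[of z0] by linarith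
  have \<sigma>2: "\<sigma> * \<sigma> = 1" using \<sigma> by (simp add: abs_if split: if_splits)
  have point: "L q \<le> D (z - (\<chi> l. q l / T))" for q
  proof -
    have nn: "0 \<le> (\<Sum>l\<in>UNIV. A l * ((?a + \<bar>q l\<bar>) / T))"
      using A a T by (intro sum_nonneg mult_nonneg_nonneg) auto
    show ?thesis
    proof (cases "q \<in> G")
      case True
      \<comment> \<open>the displacement of \<open>z - q / T\<close> from the corner \<open>z0\<close>\<close>
      define h :: "real ^ 'n" where "h = (\<chi> l. (?a - \<sigma> * q l) / T)"
      have h: "h $ l \<ge> 0" for l using True T by (simp add: h_def G_def)
      have "\<sigma> * h $ l = \<sigma> * ?a / T - q l / T" for l
        using \<sigma>2 by (simp add: h_def algebra_simps diff_divide_distrib flip: mult.assoc)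
      then have "z0 + \<sigma> *\<^sub>R h = z - (\<chi> l. q l / T)"
        by (simp add: z_def vec_eq_iff)
      then have "D z0 - (\<Sum>l\<in>UNIV. A l * h $ l) \<le> D (z - (\<chi> l. q l / T))" using D[OF h] by simp
      moreover have "(\<Sum>l\<in>UNIV. A l * h $ l) \<le> (\<Sum>l\<in>UNIV. A l * ((?a + \<bar>q l\<bar>) / T))"
      proof (intro sum_mono mult_left_mono A)
        fix l
        have "- (\<sigma> * q l) \<le> \<bar>q l\<bar>" using \<sigma> by (auto simp: abs_if split: if_splits)
        then show "h $ l \<le> (?a + \<bar>q l\<bar>) / T" using T by (simp add: h_def divide_right_mono)
      qed
      ultimately show ?thesis using True by (simp add: L_def)
    next
      case False
      then show ?thesis using nn \<delta>[of "z - (\<chi> l. q l / T)"] by (simp add: L_def)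
    qed
  qed
  have iA: "integrable jackson_product (\<lambda>q. A l * ((?a + \<bar>q l\<bar>) / T))" for l
    using jackson_product_abs(1)[of l] by (intro integrable_mult_right integrable_divide_zero Bochner_Integration.integrable_add) auto
  have iG: "integrable jackson_product (\<lambda>q. indicator G q * (D z0 + \<delta>))"
    using G by (intro integrable_mult_left integrable_real_indicator) (auto simp: Q.emeasure_finite less_top[symmetric])
  have iL: "integrable jackson_product L"
    unfolding L_def using iA iG by (intro Bochner_Integration.integrable_diff Bochner_Integration.integrable_sum) auto
  have "(\<integral>q. L q \<partial>jackson_product) = measure jackson_product G * (D z0 + \<delta>) - \<delta>
      - (\<Sum>l\<in>UNIV. A l * ((?a + (\<integral>q. \<bar>q l\<bar> \<partial>jackson_product)) / T))"
  proof -
    have "(\<integral>q. ?a + \<bar>q l\<bar> \<partial>jackson_product) = ?a + (\<integral>q. \<bar>q l\<bar> \<partial>jackson_product)" for l :: 'n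
      using jackson_product_abs(1)[of l] by (subst Bochner_Integration.integral_add) (auto simp: Q.prob_space)
    then show ?thesis
      unfolding L_def using iA iG G by (simp add: Q.prob_space)
  qed
  also have "\<dots> \<ge> 3 / 4 * (D z0 + \<delta>) - \<delta> - (\<Sum>l\<in>UNIV. A l * ((?a + C2) / T))"
  proof (intro diff_mono mult_right_mono sum_mono mult_left_mono order_refl divide_right_mono add_left_mono)
    show "3 / 4 \<le> measure jackson_product G" unfolding G_def by (rule jackson_product_box[OF \<sigma>])
  qed (use A \<delta>0 T jackson_product_abs(2) in auto)
  also have "3 / 4 * (D z0 + \<delta>) - \<delta> - (\<Sum>l\<in>UNIV. A l * ((?a + C2) / T)) =
      3 / 4 * D z0 - \<delta> / 4 - (\<Sum>l\<in>UNIV. A l) * (?a + C2) / T"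
  proof -
    have "(\<Sum>l\<in>UNIV. A l * ((?a + C2) / T)) = (\<Sum>l\<in>UNIV. A l) * (?a + C2) / T"
      by (simp add: sum_distrib_right sum_divide_distrib)
    then show ?thesis by argo
  qed
  finally show ?thesis
    using integral_mono[OF iL int point] by linarith
qed

text \<open>Move along one coordinate axis at a time and apply the mean value theorem on each segment.\<close>

lemma cdf_increment_le:
  fixes F :: "real ^ 'n \<Rightarrow> real" and A :: "'n \<Rightarrow> real"
  assumes diff: "F differentiable_on UNIV"
    and A: "\<And>j y. partial_deriv j F y \<le> A j"
    and h: "\<And>l. h $ l \<ge> 0"
  shows "F (z + h) \<le> F z + (\<Sum>l\<in>UNIV. A l * h $ l)"
proof -
  have one: "F (y + s *\<^sub>R axis j 1) \<le> F y + A j * s" if "s \<ge> 0" for y j s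
  proof (cases "s = 0")
    case False
    define g where "g r = F (y + r *\<^sub>R axis j 1)" for r
    have "g differentiable (at r)" for r
    proof -
      have "F differentiable (at (y + r *\<^sub>R axis j 1))" using diff by (simp add: differentiable_on_def)
      moreover have "(\<lambda>r. y + r *\<^sub>R axis j 1) differentiable (at r)"
        by (intro differentiable_add differentiable_const differentiable_scaleR differentiable_ident)
      ultimately show ?thesis
        unfolding g_def using differentiable_chain_at[of "\<lambda>r. y + r *\<^sub>R axis j 1" r F] by (simp add: o_def)
    qed
    then have dg: "DERIV g r :> deriv g r" for r
      by (simp add: DERIV_deriv_iff_real_differentiable)
    have "deriv g r = partial_deriv j F (y + r *\<^sub>R axis j 1)" for r
    proof -
      have "DERIV (\<lambda>x. g (x + r)) 0 :> deriv g r"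
        using dg[of r] DERIV_shift[of g "deriv g r" 0 r] by simp
      then have "deriv (\<lambda>x. g (x + r)) 0 = deriv g r" by (rule DERIV_imp_deriv)
      then show ?thesis by (simp add: g_def partial_deriv_def algebra_simps)
    qed
    then have dle: "deriv g r \<le> A j" for r using A by simp
    have "0 < s" using that False by simp
    then obtain r where "g s - g 0 = (s - 0) * deriv g r"
      using MVT2[of 0 s g "deriv g"] dg by blast
    also have "(s - 0) * deriv g r \<le> s * A j" using that dle by (simp add: mult_left_mono)
    finally show ?thesis by (simp add: g_def mult.commute)
  qed simp
  have "F (z + (\<Sum>l\<in>S. h $ l *\<^sub>R axis l 1)) \<le> F z + (\<Sum>l\<in>S. A l * h $ l)" if "finite S" for S
    using that
  proof induction
    case (insert j S)
    have "F (z + (\<Sum>l\<in>insert j S. h $ l *\<^sub>R axis l 1)) =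
        F (z + (\<Sum>l\<in>S. h $ l *\<^sub>R axis l 1) + h $ j *\<^sub>R axis j 1)"
      using insert by (simp add: algebra_simps)
    also have "\<dots> \<le> F (z + (\<Sum>l\<in>S. h $ l *\<^sub>R axis l 1)) + A j * h $ j" by (rule one) (rule h)
    also have "\<dots> \<le> F z + (\<Sum>l\<in>insert j S. A l * h $ l)" using insert by simp
    finally show ?case .
  qed simp
  from this[of UNIV] have "F (z + (\<Sum>l\<in>UNIV. h $ l *\<^sub>R axis l 1)) \<le> F z + (\<Sum>l\<in>UNIV. A l * h $ l)" by simp
  moreover have "(\<Sum>l\<in>UNIV. h $ l *\<^sub>R axis l 1) = h"
    using basis_expansion[of h] by (simp add: scalar_mult_eq_scaleR)
  ultimately show ?thesis by simp
qed

lemma joint_cdf_mono: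
  assumes "prob_space M" and X [measurable]: "X \<in> borel_measurable M" and h: "\<And>l. (h :: real ^ 'n) $ l \<ge> 0"
  shows "joint_cdf M X z \<le> joint_cdf M X (z + h)"
proof -
  interpret prob_space M by fact
  show ?thesis unfolding joint_cdf_vec
  proof (rule finite_measure_mono)
    show "{\<omega> \<in> space M. \<forall>j. X \<omega> $ j \<le> z $ j} \<subseteq> {\<omega> \<in> space M. \<forall>j. X \<omega> $ j \<le> (z + h) $ j}"
      using h by (auto intro: add_increasing2)
  qed measurable
qed

lemma cmod_mu: "cmod (mu \<alpha>) = fact (card \<alpha> - 1)"
  by (simp add: mu_def norm_mult norm_power)

text \<open>In the combination of the previous section the one-block partition contributes \<open>D\<close> itself with
  coefficient \<open>1\<close>. All other partitions consist of proper subsets, and their contribution is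
  estimated by the marginal differences \<open>d J\<close>; exchanging the sums over partitions and blocks collects the
  weight of each \<open>J\<close>.\<close>

lemma smoothed_difference_bound:
  fixes X :: "'a \<Rightarrow> real ^ 'n" and Y :: "'b \<Rightarrow> real ^ 'n" and z :: "real ^ 'n"
  assumes M: "prob_space M" and X: "X \<in> borel_measurable M"
    and N: "prob_space N" and Y: "Y \<in> borel_measurable N" and T: "T > 0"
    and I: "Lambda_integral M X N Y T = ennreal r" "r \<ge> 0"
    and d: "\<And>J z. J \<noteq> {} \<Longrightarrow> J \<noteq> UNIV \<Longrightarrow> \<bar>joint_cdf M (proj J X) (\<lambda>j\<in>J. z $ j) - joint_cdf N (proj J Y) (\<lambda>j\<in>J. z $ j)\<bar> \<le> d J"
  shows "\<bar>\<integral>q. joint_cdf M X (z - (\<chi> l. q l / T)) - joint_cdf N Y (z - (\<chi> l. q l / T)) \<partial>jackson_product\<bar>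
    \<le> 1 / (2 * pi) ^ CARD('n) * r + (\<Sum>J | J \<noteq> {} \<and> J \<subset> (UNIV :: 'n set). real (B_coeff (CARD('n) - card J)) * d J)"
proof -
  interpret Q: prob_space "jackson_product :: ('n \<Rightarrow> real) measure"
    by (rule prob_space_PiM_const[OF prob_space_jackson_measure])
  note PM = prob_space_PiM_const[OF M] and PN = prob_space_PiM_const[OF N]
  define D where "D \<alpha> z = joint_cdf (Pi\<^sub>M \<alpha> (\<lambda>_. M)) (blockwise_copy \<alpha> X) z
     - joint_cdf (Pi\<^sub>M \<alpha> (\<lambda>_. N)) (blockwise_copy \<alpha> Y) z" for \<alpha> z
  define ID where "ID \<alpha> = (\<integral>q. D \<alpha> (z - (\<chi> l. q l / T)) \<partial>jackson_product)" for \<alpha>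
  let ?P = "{\<alpha>. partition_on (UNIV :: 'n set) \<alpha>}"
  let ?A = "?P - {{UNIV}}" and ?B = "{J. J \<noteq> {} \<and> J \<subset> (UNIV :: 'n set)}"
  have U: "{UNIV} \<in> ?P" by (simp add: partition_on_space)
  have D_U: "D {UNIV} w = joint_cdf M X w - joint_cdf N Y w" for w
    unfolding D_def joint_cdf_blockwise_copy[OF M X CollectD[OF U]] joint_cdf_blockwise_copy[OF N Y CollectD[OF U]]
    by (simp add: joint_cdf_proj) (simp add: joint_cdf_vec)
  have inter: "{J. J \<in> ?B \<and> J \<in> \<alpha>} = \<alpha>" if "\<alpha> \<in> ?A" for \<alpha>
  proof -
    have p: "partition_on UNIV \<alpha>" using that by simp
    have "UNIV \<notin> \<alpha>"
    proof
      assume u: "UNIV \<in> \<alpha>"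
      have "J = UNIV" if "J \<in> \<alpha>" for J
        using partition_onD2[OF p] partition_onD3[OF p] u that by (metis disjnt_def inf_top.right_neutral pairwiseD)
      then have "\<alpha> = {UNIV}" using u by blast
      then show False using that by simp
    qed
    then show ?thesis using partition_onD3[OF p] by auto
  qed
  have D_le: "\<bar>D \<alpha> w\<bar> \<le> (\<Sum>J\<in>\<alpha>. d J)" if "\<alpha> \<in> ?A" for \<alpha> w
  proof -
    have p: "partition_on UNIV \<alpha>" using that by simp
    have le1: "\<bar>joint_cdf P (proj J W) v\<bar> \<le> 1" if "prob_space P" for P :: "'c measure" and W :: "'c \<Rightarrow> real ^ 'n" and J v
      using prob_space.prob_le_1[OF that] by (simp add: joint_cdf_def)
    have "\<bar>D \<alpha> w\<bar> = norm ((\<Prod>J\<in>\<alpha>. joint_cdf M (proj J X) (\<lambda>j\<in>J. w $ j)) - (\<Prod>J\<in>\<alpha>. joint_cdf N (proj J Y) (\<lambda>j\<in>J. w $ j)))"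
      by (simp add: D_def joint_cdf_blockwise_copy[OF M X p] joint_cdf_blockwise_copy[OF N Y p])
    also have "\<dots> \<le> (\<Sum>J\<in>\<alpha>. norm (joint_cdf M (proj J X) (\<lambda>j\<in>J. w $ j) - joint_cdf N (proj J Y) (\<lambda>j\<in>J. w $ j)))"
      by (rule norm_prod_diff) (simp_all add: le1 M N)
    also have "\<dots> \<le> (\<Sum>J\<in>\<alpha>. d J)"
      using inter[OF that] by (intro sum_mono) (auto intro!: d)
    finally show ?thesis .
  qed
  have ID_le: "\<bar>ID \<alpha>\<bar> \<le> (\<Sum>J\<in>\<alpha>. d J)" if "\<alpha> \<in> ?A" for \<alpha>
  proof -
    have p: "partition_on UNIV \<alpha>" using that by simp
    have int: "integrable jackson_product (\<lambda>q. D \<alpha> (z - (\<chi> l. q l / T)))"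
      unfolding D_def
      by (intro Bochner_Integration.integrable_diff jackson_convolution(1) PM PN T
          measurable_blockwise_copy[OF X p] measurable_blockwise_copy[OF Y p])
    have "\<bar>ID \<alpha>\<bar> \<le> (\<integral>q. \<bar>D \<alpha> (z - (\<chi> l. q l / T))\<bar> \<partial>jackson_product)"
      unfolding ID_def by (rule integral_abs_bound)
    also have "\<dots> \<le> (\<integral>q. (\<Sum>J\<in>\<alpha>. d J) \<partial>(jackson_product :: ('n \<Rightarrow> real) measure))"
      by (intro integral_mono integrable_abs int D_le that) simp
    also have "\<dots> = (\<Sum>J\<in>\<alpha>. d J)" by (simp add: Q.prob_space)
    finally show ?thesis .
  qed
  have "(\<Sum>\<alpha>\<in>?P. mu \<alpha> * of_real (ID \<alpha>)) = mu {UNIV :: 'n set} * of_real (ID {UNIV}) + (\<Sum>\<alpha>\<in>?A. mu \<alpha> * of_real (ID \<alpha>))"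
    by (rule sum.remove[OF _ U]) simp
  then have "of_real (ID {UNIV}) = (\<Sum>\<alpha>\<in>?P. mu \<alpha> * of_real (ID \<alpha>)) - (\<Sum>\<alpha>\<in>?A. mu \<alpha> * of_real (ID \<alpha>))"
    by (simp add: mu_def)
  then have "\<bar>ID {UNIV}\<bar> = cmod ((\<Sum>\<alpha>\<in>?P. mu \<alpha> * of_real (ID \<alpha>)) - (\<Sum>\<alpha>\<in>?A. mu \<alpha> * of_real (ID \<alpha>)))"
    by (metis norm_of_real)
  also have "\<dots> \<le> cmod (\<Sum>\<alpha>\<in>?P. mu \<alpha> * of_real (ID \<alpha>)) + cmod (\<Sum>\<alpha>\<in>?A. mu \<alpha> * of_real (ID \<alpha>))"
    by (rule norm_triangle_ineq4)
  also have "cmod (\<Sum>\<alpha>\<in>?P. mu \<alpha> * of_real (ID \<alpha>)) \<le> 1 / (2 * pi) ^ CARD('n) * r"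
    unfolding ID_def D_def by (rule Lambda_smoothing_bound[OF M X N Y T I])
  also have "cmod (\<Sum>\<alpha>\<in>?A. mu \<alpha> * of_real (ID \<alpha>)) \<le> (\<Sum>\<alpha>\<in>?A. real (fact (card \<alpha> - 1)) * (\<Sum>J\<in>\<alpha>. d J))"
  proof (rule sum_norm_le)
    fix \<alpha> assume "\<alpha> \<in> ?A"
    then show "cmod (mu \<alpha> * of_real (ID \<alpha>)) \<le> real (fact (card \<alpha> - 1)) * (\<Sum>J\<in>\<alpha>. d J)"
      using ID_le by (simp add: norm_mult cmod_mu mult_left_mono)
  qed
  also have "\<dots> = (\<Sum>\<alpha>\<in>?A. \<Sum>J | J \<in> ?B \<and> J \<in> \<alpha>. real (fact (card \<alpha> - 1)) * d J)"
    using inter by (intro sum.cong refl) (simp add: sum_distrib_left)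
  also have "\<dots> = (\<Sum>J\<in>?B. \<Sum>\<alpha> | \<alpha> \<in> ?A \<and> J \<in> \<alpha>. real (fact (card \<alpha> - 1)) * d J)"
    by (rule sum.swap_restrict) simp_all
  also have "\<dots> = (\<Sum>J\<in>?B. real (B_coeff (CARD('n) - card J)) * d J)"
  proof (rule sum.cong[OF refl])
    fix J assume "J \<in> ?B"
    then have J: "J \<noteq> {}" "J \<noteq> UNIV" by auto
    have "{\<alpha>. \<alpha> \<in> ?A \<and> J \<in> \<alpha>} = {\<alpha>. partition_on UNIV \<alpha> \<and> J \<in> \<alpha>}" using J by auto
    then have "(\<Sum>\<alpha> | \<alpha> \<in> ?A \<and> J \<in> \<alpha>. real (fact (card \<alpha> - 1)) * d J) =
        real (\<Sum>\<alpha> | partition_on UNIV \<alpha> \<and> J \<in> \<alpha>. fact (card \<alpha> - 1)) * d J"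
      by (simp add: sum_distrib_right)
    then show "(\<Sum>\<alpha> | \<alpha> \<in> ?A \<and> J \<in> \<alpha>. real (fact (card \<alpha> - 1)) * d J) = real (B_coeff (CARD('n) - card J)) * d J"
      by (simp only: sum_partitions_containing[OF J])
  qed
  finally show ?thesis unfolding ID_def D_U by simp
qed

text \<open>With \<open>\<delta> = sup \<bar>D\<bar>\<close>, the one-sided bounds give \<open>3/4 \<bar>D w\<bar> - \<delta> / 4 - R \<le> \<eta>\<close> for all \<open>w\<close>, and the
  supremum over \<open>w\<close> yields \<open>\<delta> \<le> 2 \<eta> + 2 R\<close>.\<close>

lemma berry_esseen_real:
  fixes X :: "'a \<Rightarrow> real ^ 'n" and Y :: "'b \<Rightarrow> real ^ 'n" and A :: "'n \<Rightarrow> real"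
  assumes M: "prob_space M" and X: "X \<in> borel_measurable M"
    and N: "prob_space N" and Y: "Y \<in> borel_measurable N" and T: "T > 0"
    and diff: "joint_cdf N Y differentiable_on UNIV"
    and A: "\<And>j. A j \<ge> 0" "\<And>j y. partial_deriv j (joint_cdf N Y) y \<le> A j"
    and I: "Lambda_integral M X N Y T = ennreal r" "r \<ge> 0"
    and d: "\<And>J z. J \<noteq> {} \<Longrightarrow> J \<noteq> UNIV \<Longrightarrow> \<bar>joint_cdf M (proj J X) (\<lambda>j\<in>J. z $ j) - joint_cdf N (proj J Y) (\<lambda>j\<in>J. z $ j)\<bar> \<le> d J"
  shows "\<bar>joint_cdf M X z - joint_cdf N Y z\<bar> \<le> 2 / (2 * pi) ^ CARD('n) * r
    + 2 * (\<Sum>J | J \<noteq> {} \<and> J \<subset> (UNIV :: 'n set). real (B_coeff (CARD('n) - card J)) * d J)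
    + 2 * (\<Sum>j\<in>UNIV. A j) / T * (C1 CARD('n) + C2)"
proof -
  define D where "D w = joint_cdf M X w - joint_cdf N Y w" for w
  define \<eta> where "\<eta> = 1 / (2 * pi) ^ CARD('n) * r
    + (\<Sum>J | J \<noteq> {} \<and> J \<subset> (UNIV :: 'n set). real (B_coeff (CARD('n) - card J)) * d J)"
  define R where "R = (\<Sum>j\<in>UNIV. A j) * (C1 CARD('n) + C2) / T"
  define \<delta> where "\<delta> = (SUP w. \<bar>D w\<bar>)"
  have D1: "\<bar>D w\<bar> \<le> 1" for w
  proof -
    have "0 \<le> joint_cdf M X w" "joint_cdf M X w \<le> 1" "0 \<le> joint_cdf N Y w" "joint_cdf N Y w \<le> 1"
      using prob_space.prob_le_1[OF M] prob_space.prob_le_1[OF N] by (simp_all add: joint_cdf_def)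
    then show ?thesis by (simp add: D_def abs_le_iff)
  qed
  have bdd: "bdd_above (range (\<lambda>w. \<bar>D w\<bar>))" using D1 by (intro bdd_aboveI[of _ 1]) auto
  have \<delta>: "\<bar>D w\<bar> \<le> \<delta>" for w unfolding \<delta>_def by (rule cSUP_upper[OF _ bdd]) simp
  have int: "integrable jackson_product (\<lambda>q. D (w - (\<chi> l. q l / T)))" for w
    unfolding D_def by (intro Bochner_Integration.integrable_diff jackson_convolution(1) M N X Y T)
  have E: "\<bar>\<integral>q. D (w - (\<chi> l. q l / T)) \<partial>jackson_product\<bar> \<le> \<eta>" for w
    unfolding D_def \<eta>_def by (rule smoothed_difference_bound[OF M X N Y T I d])
  note lip = cdf_increment_le[OF diff A(2)]
  have main: "3 / 4 * \<bar>D w\<bar> - \<delta> / 4 - R \<le> \<eta>" for w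
  proof -
    have "3 / 4 * D w - \<delta> / 4 - R \<le> (\<integral>q. D (w + (\<chi> l. 1 * C1 CARD('n) / T) - (\<chi> l. q l / T)) \<partial>jackson_product)"
      unfolding R_def
    proof (rule smoothing_lower_bound[OF T _ A(1) \<delta> _ int])
      fix h :: "real ^ 'n" assume h: "\<And>l. 0 \<le> h $ l"
      show "D w - (\<Sum>l\<in>UNIV. A l * h $ l) \<le> D (w + 1 *\<^sub>R h)"
        using lip[OF h, of w] joint_cdf_mono[OF M X h, of w] by (simp add: D_def)
    qed simp
    then have 1: "3 / 4 * D w - \<delta> / 4 - R \<le> \<eta>" using E order_trans abs_le_D1 by blast
    have "3 / 4 * (- D w) - \<delta> / 4 - R \<le> (\<integral>q. - D (w + (\<chi> l. -1 * C1 CARD('n) / T) - (\<chi> l. q l / T)) \<partial>jackson_product)"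
      unfolding R_def
    proof (rule smoothing_lower_bound[OF T _ A(1)])
      show "\<bar>- D w\<bar> \<le> \<delta>" for w using \<delta> by simp
      fix h :: "real ^ 'n" assume h: "\<And>l. 0 \<le> h $ l"
      show "- D w - (\<Sum>l\<in>UNIV. A l * h $ l) \<le> - D (w + (-1) *\<^sub>R h)"
        using lip[OF h, of "w - h"] joint_cdf_mono[OF M X h, of "w - h"] by (simp add: D_def)
    qed (use int in auto)
    then have "3 / 4 * (- D w) - \<delta> / 4 - R \<le> - (\<integral>q. D (w + (\<chi> l. -1 * C1 CARD('n) / T) - (\<chi> l. q l / T)) \<partial>jackson_product)"
      by simp
    also have "\<dots> \<le> \<eta>" using E abs_le_D2 by blast
    finally show ?thesis using 1 by (cases "D w \<ge> 0") simp_all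
  qed
  have "\<bar>D w\<bar> \<le> 4 / 3 * (\<delta> / 4 + R + \<eta>)" for w
    using main[of w] by (simp add: field_simps)
  then have "\<delta> \<le> 4 / 3 * (\<delta> / 4 + R + \<eta>)"
    unfolding \<delta>_def by (intro cSUP_least) auto
  then have "\<delta> \<le> 2 * \<eta> + 2 * R" by simp
  then have "\<bar>D z\<bar> \<le> 2 * \<eta> + 2 * R" using \<delta>[of z] by linarith
  also have "2 * \<eta> + 2 * R = 2 / (2 * pi) ^ CARD('n) * r
    + 2 * (\<Sum>J | J \<noteq> {} \<and> J \<subset> (UNIV :: 'n set). real (B_coeff (CARD('n) - card J)) * d J)
    + 2 * (\<Sum>j\<in>UNIV. A j) / T * (C1 CARD('n) + C2)"
    by (simp add: \<eta>_def R_def algebra_simps)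
  finally show ?thesis by (simp add: D_def)
qed

section \<open>Finiteness of the integral\<close>

lemma integrable_exp_inner:
  fixes X :: "'a \<Rightarrow> real ^ 'n"
  assumes "prob_space M" and [measurable]: "X \<in> borel_measurable M"
  shows "integrable M (\<lambda>\<omega>. exp (\<i> * complex_of_real (t \<bullet> X \<omega>)))"
proof -
  interpret prob_space M by fact
  show ?thesis by (intro integrable_const_bound[where B = 1] AE_I2) auto
qed

lemma cmod_char_fun_le_1:
  assumes "prob_space M" and "X \<in> borel_measurable M"
  shows "cmod (char_fun M X t) \<le> 1"
proof -
  interpret prob_space M by fact
  have "cmod (char_fun M X t) \<le> (\<integral>\<omega>. cmod (exp (\<i> * complex_of_real (t \<bullet> X \<omega>))) \<partial>M)"
    unfolding char_fun_def by (rule integral_norm_bound)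
  then show ?thesis by (simp add: prob_space)
qed

lemma cmod_exp_diff_le: "cmod (exp (\<i> * complex_of_real x) - exp (\<i> * complex_of_real y)) \<le> \<bar>x - y\<bar>"
proof -
  have "exp (\<i> * complex_of_real x) - exp (\<i> * complex_of_real y) =
      exp (\<i> * complex_of_real y) * (exp (\<i> * complex_of_real (x - y)) - 1)"
    by (simp add: algebra_simps exp_add[symmetric])
  then show ?thesis
    using iexp_approx1[of "x - y" 0] by (simp add: norm_mult)
qed

lemma char_fun_coordinate_lipschitz:
  fixes X :: "'a \<Rightarrow> real ^ 'n"
  assumes M: "prob_space M" and X: "integrable M X" and ab: "a - b = c *\<^sub>R axis l 1"
  shows "cmod (char_fun M X a - char_fun M X b) \<le> \<bar>c\<bar> * (\<integral>\<omega>. norm (X \<omega>) \<partial>M)"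
proof -
  have X' [measurable]: "X \<in> borel_measurable M" using X by simp
  note i = integrable_exp_inner[OF M X']
  have "cmod (char_fun M X a - char_fun M X b) =
      cmod (\<integral>\<omega>. exp (\<i> * complex_of_real (a \<bullet> X \<omega>)) - exp (\<i> * complex_of_real (b \<bullet> X \<omega>)) \<partial>M)"
    unfolding char_fun_def by (simp only: Bochner_Integration.integral_diff[OF i i])
  also have "\<dots> \<le> (\<integral>\<omega>. cmod (exp (\<i> * complex_of_real (a \<bullet> X \<omega>)) - exp (\<i> * complex_of_real (b \<bullet> X \<omega>))) \<partial>M)"
    by (rule integral_norm_bound)
  also have "\<dots> \<le> (\<integral>\<omega>. \<bar>c\<bar> * norm (X \<omega>) \<partial>M)"
  proof (rule integral_mono)
    fix \<omega>
    have "a \<bullet> X \<omega> - b \<bullet> X \<omega> = c * X \<omega> $ l"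
      unfolding inner_diff_left[symmetric] ab by (simp add: inner_axis')
    then have "cmod (exp (\<i> * complex_of_real (a \<bullet> X \<omega>)) - exp (\<i> * complex_of_real (b \<bullet> X \<omega>))) \<le> \<bar>c\<bar> * \<bar>X \<omega> $ l\<bar>"
      using cmod_exp_diff_le[of "a \<bullet> X \<omega>" "b \<bullet> X \<omega>"] by (simp add: abs_mult)
    also have "\<dots> \<le> \<bar>c\<bar> * norm (X \<omega>)" by (intro mult_left_mono component_le_norm_cart) simp
    finally show "cmod (exp (\<i> * complex_of_real (a \<bullet> X \<omega>)) - exp (\<i> * complex_of_real (b \<bullet> X \<omega>))) \<le> \<bar>c\<bar> * norm (X \<omega>)" .
  qed (use X i in \<open>auto intro!: integrable_norm Bochner_Integration.integrable_diff\<close>)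
  finally show ?thesis by simp
qed

text \<open>Zeroing one coordinate changes each factor of each product by at most \<open>\<bar>t\<^sub>l\<bar> E \<parallel>X\<parallel>\<close>, and all
  factors have absolute value at most \<open>1\<close>.\<close>

lemma Lambda_coordinate_lipschitz:
  fixes X :: "'a \<Rightarrow> real ^ 'n"
  assumes M: "prob_space M" and X: "integrable M X"
  shows "cmod (Lambda (char_fun M X) t - Lambda (char_fun M X) (psi (- {l}) t)) \<le>
    (\<Sum>\<alpha> | partition_on (UNIV :: 'n set) \<alpha>. cmod (mu \<alpha>) * real (card \<alpha>)) * (\<integral>\<omega>. norm (X \<omega>) \<partial>M) * \<bar>t $ l\<bar>"
proof -
  let ?P = "{\<alpha>. partition_on (UNIV :: 'n set) \<alpha>}"
  let ?E = "\<integral>\<omega>. norm (X \<omega>) \<partial>M"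
  let ?s = "psi (- {l}) t"
  note le1 = cmod_char_fun_le_1[OF M borel_measurable_integrable[OF X]]
  have "Lambda (char_fun M X) t - Lambda (char_fun M X) ?s =
      (\<Sum>\<alpha>\<in>?P. mu \<alpha> * ((\<Prod>J\<in>\<alpha>. char_fun M X (psi J t)) - (\<Prod>J\<in>\<alpha>. char_fun M X (psi J ?s))))"
    by (simp add: Lambda_def sum_subtractf right_diff_distrib)
  also have "cmod \<dots> \<le> (\<Sum>\<alpha>\<in>?P. cmod (mu \<alpha>) * (real (card \<alpha>) * (\<bar>t $ l\<bar> * ?E)))"
  proof (rule sum_norm_le)
    fix \<alpha> :: "'n set set"
    have "cmod ((\<Prod>J\<in>\<alpha>. char_fun M X (psi J t)) - (\<Prod>J\<in>\<alpha>. char_fun M X (psi J ?s))) \<le>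
        (\<Sum>J\<in>\<alpha>. cmod (char_fun M X (psi J t) - char_fun M X (psi J ?s)))"
      by (rule norm_prod_diff) (rule le1)+
    also have "\<dots> \<le> (\<Sum>J\<in>\<alpha>. \<bar>t $ l\<bar> * ?E)"
    proof (rule sum_mono)
      fix J :: "'n set"
      have "psi J t - psi J ?s = (if l \<in> J then t $ l else 0) *\<^sub>R axis l 1"
        by (auto simp: psi_def vec_eq_iff axis_def)
      from char_fun_coordinate_lipschitz[OF M X this]
      have "cmod (char_fun M X (psi J t) - char_fun M X (psi J ?s)) \<le> \<bar>if l \<in> J then t $ l else 0\<bar> * ?E" .
      also have "\<dots> \<le> \<bar>t $ l\<bar> * ?E" by (intro mult_right_mono) auto
      finally show "cmod (char_fun M X (psi J t) - char_fun M X (psi J ?s)) \<le> \<bar>t $ l\<bar> * ?E" .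
    qed
    finally show "cmod (mu \<alpha> * ((\<Prod>J\<in>\<alpha>. char_fun M X (psi J t)) - (\<Prod>J\<in>\<alpha>. char_fun M X (psi J ?s))))
        \<le> cmod (mu \<alpha>) * (real (card \<alpha>) * (\<bar>t $ l\<bar> * ?E))"
      by (simp add: norm_mult mult_left_mono)
  qed
  also have "\<dots> = (\<Sum>\<alpha>\<in>?P. cmod (mu \<alpha>) * real (card \<alpha>)) * ?E * \<bar>t $ l\<bar>"
    by (simp add: sum_distrib_left sum_distrib_right mult_ac)
  finally show ?thesis .
qed

text \<open>In dimension one \<open>\<Lambda>\<close> is the identity and does not vanish at the origin, but both characteristic functions
  have the value \<open>1\<close> there.\<close>

lemma Lambda_difference_eq_0:
  fixes X :: "'a \<Rightarrow> real ^ 'n" and Y :: "'b \<Rightarrow> real ^ 'n"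
  assumes M: "prob_space M" and N: "prob_space N" and s: "s $ l = 0"
  shows "Lambda (char_fun M X) s = Lambda (char_fun N Y) s"
proof -
  have X0: "char_fun M X 0 = 1" and Y0: "char_fun N Y 0 = 1"
    using prob_space.prob_space[OF M] prob_space.prob_space[OF N] by (simp_all add: char_fun_def)
  show ?thesis
  proof (cases "CARD('n) \<ge> 2")
    case True
    then show ?thesis using Lambda_eq_0[of "char_fun M X" s l] Lambda_eq_0[of "char_fun N Y" s l] X0 Y0 s by simp
  next
    case False
    have "k = l" for k
    proof (rule ccontr)
      assume "k \<noteq> l"
      then have "card {k, l} = 2" by simp
      moreover have "card {k, l} \<le> CARD('n)" by (rule card_mono) auto
      ultimately show False using False by simp
    qed
    then have "s $ k = 0" for k using s by metis
    then have "psi J s = 0" for J by (simp add: psi_def vec_eq_iff)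
    then show ?thesis by (simp add: Lambda_def X0 Y0)
  qed
qed

lemma nn_integral_powr_finite:
  assumes a: "a > -1" and T: "T > 0"
  shows "(\<integral>\<^sup>+s. ennreal (\<bar>s\<bar> powr a) * indicator {-T..T} s \<partial>lborel) < \<infinity>"
proof -
  have "((\<lambda>s. if s \<in> {0..T} then s powr a else 0) has_integral (T powr (a + 1) / (a + 1))) UNIV"
    unfolding has_integral_restrict_UNIV using T by (intro has_integral_powr_from_0[OF a]) simp
  then have "(\<integral>\<^sup>+s. ennreal (if s \<in> {0..T} then s powr a else 0) \<partial>lborel) = ennreal (T powr (a + 1) / (a + 1))"
    by (intro nn_integral_has_integral_lborel) auto
  moreover have "(\<integral>\<^sup>+s. ennreal (\<bar>s\<bar> powr a) * indicator {-T..T} s \<partial>lborel) =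
      2 * (\<integral>\<^sup>+s. ennreal (\<bar>s\<bar> powr a) * indicator {-T..T} s * indicator {0..} s \<partial>lborel)"
    by (rule nn_integral_even) (auto simp: indicator_def)
  moreover have "(\<integral>\<^sup>+s. ennreal (\<bar>s\<bar> powr a) * indicator {-T..T} s * indicator {0..} s \<partial>lborel) =
      (\<integral>\<^sup>+s. ennreal (if s \<in> {0..T} then s powr a else 0) \<partial>lborel)"
    using T by (intro nn_integral_cong) (auto simp: indicator_def)
  ultimately show ?thesis by (simp add: ennreal_mult_less_top)
qed

lemma nn_integral_lborel_prod_vec:
  fixes k :: "real \<Rightarrow> ennreal"
  assumes [measurable]: "k \<in> borel_measurable borel"
  shows "(\<integral>\<^sup>+t. (\<Prod>l\<in>UNIV. k (t $ l)) \<partial>(lborel :: (real ^ 'n) measure)) = (\<integral>\<^sup>+s. k s \<partial>lborel) ^ CARD('n)"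
proof -
  have B: "(Basis :: (real ^ 'n) set) = (\<lambda>l. axis l 1) ` UNIV"
    by (auto simp: Basis_vec_def)
  have inj: "inj (\<lambda>l :: 'n. axis l (1 :: real))"
    by (rule injI) (simp add: axis_eq_axis)
  have "(\<integral>\<^sup>+t. (\<Prod>b\<in>Basis. k (t \<bullet> b)) \<partial>(lborel :: (real ^ 'n) measure)) = (\<Prod>b\<in>(Basis :: (real ^ 'n) set). \<integral>\<^sup>+s. k s \<partial>lborel)"
    by (rule nn_integral_lborel_prod) auto
  then show ?thesis
    unfolding B prod.reindex[OF inj] by (simp add: inner_axis)
qed

text \<open>The smallest \<open>\<bar>t\<^sub>l\<bar>\<close> is at most the geometric mean of all of them, which spreads the zero on the
  coordinate hyperplanes evenly over the \<open>m\<close> singular factors of the denominator.\<close>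

lemma Lambda_integral_finite:
  fixes X :: "'a \<Rightarrow> real ^ 'n" and Y :: "'b \<Rightarrow> real ^ 'n"
  assumes M: "prob_space M" and X: "integrable M X" and N: "prob_space N" and Y: "integrable N Y" and T: "T > 0"
  shows "Lambda_integral M X N Y T < \<infinity>"
proof -
  define S where "S = (\<Sum>\<alpha> | partition_on (UNIV :: 'n set) \<alpha>. cmod (mu \<alpha>) * real (card \<alpha>))"
  define C where "C = S * (\<integral>\<omega>. norm (X \<omega>) \<partial>M) + S * (\<integral>\<omega>. norm (Y \<omega>) \<partial>N)"
  define \<Delta> where "\<Delta> t = Lambda (char_fun M X) t - Lambda (char_fun N Y) t" for t
  define e where "e = 1 / real CARD('n)"
  define k where "k s = ennreal (\<bar>s\<bar> powr (e - 1)) * indicator {-T..T} s" for s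
  have S: "S \<ge> 0" unfolding S_def by (intro sum_nonneg) auto
  have C: "C \<ge> 0" unfolding C_def using S by (intro add_nonneg_nonneg mult_nonneg_nonneg) auto
  have coord: "cmod (\<Delta> t) \<le> C * \<bar>t $ l\<bar>" for t l
  proof -
    let ?s = "psi (- {l}) t"
    have "?s $ l = 0" by (simp add: psi_def)
    then have "Lambda (char_fun M X) ?s = Lambda (char_fun N Y) ?s" by (rule Lambda_difference_eq_0[OF M N])
    then have "\<Delta> t = (Lambda (char_fun M X) t - Lambda (char_fun M X) ?s) - (Lambda (char_fun N Y) t - Lambda (char_fun N Y) ?s)"
      by (simp add: \<Delta>_def)
    also have "cmod \<dots> \<le> cmod (Lambda (char_fun M X) t - Lambda (char_fun M X) ?s) + cmod (Lambda (char_fun N Y) t - Lambda (char_fun N Y) ?s)"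
      by (rule norm_triangle_ineq4)
    also have "\<dots> \<le> S * (\<integral>\<omega>. norm (X \<omega>) \<partial>M) * \<bar>t $ l\<bar> + S * (\<integral>\<omega>. norm (Y \<omega>) \<partial>N) * \<bar>t $ l\<bar>"
      unfolding S_def by (intro add_mono Lambda_coordinate_lipschitz M N X Y)
    finally show ?thesis by (simp add: C_def algebra_simps)
  qed
  have geo: "cmod (\<Delta> t) \<le> C * (\<Prod>l\<in>UNIV. \<bar>t $ l\<bar> powr e)" for t
  proof -
    obtain l0 where l0: "\<And>l. \<bar>t $ l0\<bar> \<le> \<bar>t $ l\<bar>"
      using ex_is_arg_min_if_finite[of UNIV "\<lambda>l. \<bar>t $ l\<bar>"] by (auto simp: is_arg_min_linorder)
    have "\<bar>t $ l0\<bar> = (\<Prod>l\<in>(UNIV :: 'n set). \<bar>t $ l0\<bar> powr e)"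
      by (cases "t $ l0 = 0") (auto simp: powr_power e_def)
    also have "\<dots> \<le> (\<Prod>l\<in>UNIV. \<bar>t $ l\<bar> powr e)"
      using l0 by (intro prod_mono) (auto intro!: powr_mono2 simp: e_def)
    finally show ?thesis using coord[of t l0] mult_left_mono[OF _ C] by (meson order_trans)
  qed
  have "Lambda_integral M X N Y T \<le> (\<integral>\<^sup>+t. ennreal C * (\<Prod>l\<in>UNIV. k (t $ l)) \<partial>(lborel :: (real ^ 'n) measure))"
    unfolding Lambda_integral_def
  proof (rule nn_integral_mono_AE)
    show "AE t in lborel. ennreal (cmod ((Lambda (char_fun M X) t - Lambda (char_fun N Y) t) / complex_of_real (\<Prod>l\<in>UNIV. t $ l)))
        * indicator {t. infnorm t \<le> T} t \<le> ennreal C * (\<Prod>l\<in>UNIV. k (t $ l))"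
      using AE_lborel_vec_nonzero
    proof eventually_elim
      case (elim t)
      show ?case
      proof (cases "infnorm t \<le> T")
        case True
        then have tT: "\<bar>t $ l\<bar> \<le> T" for l by (simp add: infnorm_le_iff_vec)
        have tT': "t $ l \<in> {-T..T}" for l using tT[of l] by (simp add: abs_le_iff)
        have n: "cmod (complex_of_real (\<Prod>l\<in>UNIV. t $ l)) = (\<Prod>l\<in>UNIV. \<bar>t $ l\<bar>)"
          unfolding norm_of_real by (rule abs_prod)
        have "cmod (\<Delta> t / complex_of_real (\<Prod>l\<in>UNIV. t $ l)) \<le> C * (\<Prod>l\<in>UNIV. \<bar>t $ l\<bar> powr e) / (\<Prod>l\<in>UNIV. \<bar>t $ l\<bar>)"
          unfolding norm_divide n by (intro divide_right_mono geo prod_nonneg) auto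
        also have "\<dots> = C * (\<Prod>l\<in>UNIV. \<bar>t $ l\<bar> powr (e - 1))"
          using elim by (simp add: prod_dividef powr_diff)
        finally have "ennreal (cmod (\<Delta> t / complex_of_real (\<Prod>l\<in>UNIV. t $ l))) \<le> ennreal C * (\<Prod>l\<in>UNIV. ennreal (\<bar>t $ l\<bar> powr (e - 1)))"
          using C by (simp add: prod_ennreal ennreal_mult[symmetric] ennreal_leI prod_nonneg)
        also have "(\<Prod>l\<in>UNIV. ennreal (\<bar>t $ l\<bar> powr (e - 1))) = (\<Prod>l\<in>UNIV. k (t $ l))"
          using tT' by (simp add: k_def)
        finally show ?thesis using True by (simp add: \<Delta>_def)
      qed simp
    qed
  qed
  also have "\<dots> = ennreal C * (\<integral>\<^sup>+s. k s \<partial>lborel) ^ CARD('n)"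
  proof -
    have [measurable]: "k \<in> borel_measurable borel" unfolding k_def by measurable
    show ?thesis by (subst nn_integral_cmult) (simp_all add: nn_integral_lborel_prod_vec)
  qed
  also have "\<dots> < \<infinity>"
  proof -
    have "(\<integral>\<^sup>+s. k s \<partial>lborel) < \<infinity>"
      unfolding k_def by (rule nn_integral_powr_finite[OF _ T]) (simp add: e_def)
    then show ?thesis by (simp add: ennreal_mult_less_top power_less_top_ennreal)
  qed
  finally show ?thesis .
qed

section \<open>The inequality\<close>

theorem theorem2:
  fixes M :: "'a measure" and N :: "'b measure"
    and X :: "'a \<Rightarrow> real ^ 'n" and Y :: "'b \<Rightarrow> real ^ 'n"
    and T :: real
  assumes "prob_space M" and "X \<in> borel_measurable M"
    and "prob_space N" and "Y \<in> borel_measurable N"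
    and "joint_cdf N Y differentiable_on UNIV"
    and "T > 0"
  shows "((SUP z. ennreal \<bar>joint_cdf M X z - joint_cdf N Y z\<bar>)
      \<le> ennreal (2 / (2 * pi) ^ CARD('n)) * Lambda_integral M X N Y T
        + 2 * (\<Sum>J | J \<noteq> {} \<and> J \<subset> (UNIV :: 'n set).
                 of_nat (B_coeff (CARD('n) - card J)) *
                 (SUP z \<in> J \<rightarrow>\<^sub>E UNIV.
                    ennreal \<bar>joint_cdf M (proj J X) z - joint_cdf N (proj J Y) z\<bar>))
        + 2 * (\<Sum>j\<in>UNIV. A_coeff N Y j) / ennreal T * ennreal (C1 CARD('n) + C2))
    \<and> (integrable M X \<and> integrable N Y \<longrightarrow> Lambda_integral M X N Y T < \<infinity>)"
    (is "?bound \<and> ?finite")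
proof
  show ?finite using Lambda_integral_finite[OF assms(1) _ assms(3) _ assms(6)] by blast
next
  let ?m = "CARD('n)" and ?I = "Lambda_integral M X N Y T" and ?A = "A_coeff N Y"
  let ?S = "\<lambda>J. SUP z \<in> J \<rightarrow>\<^sub>E UNIV. ennreal \<bar>joint_cdf M (proj J X) z - joint_cdf N (proj J Y) z\<bar>"
  have T: "T > 0" by fact
  have C: "C1 ?m + C2 > 0" using C1_pos[of ?m] by (simp add: C2_def add_pos_pos)
  show ?bound
  proof (cases "?I = \<infinity> \<or> (\<exists>j. ?A j = \<infinity>)")
    case True
    then show ?thesis
    proof
      assume "?I = \<infinity>"
      then have "ennreal (2 / (2 * pi) ^ ?m) * ?I = \<infinity>"
        by (simp add: ennreal_mult_eq_top_iff)
      then show ?thesis by simp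
    next
      assume "\<exists>j. ?A j = \<infinity>"
      then obtain j where "?A j = \<infinity>" by blast
      moreover have "?A j \<le> (\<Sum>j\<in>UNIV. ?A j)" by (rule member_le_sum) auto
      ultimately have "(\<Sum>j\<in>UNIV. ?A j) = \<infinity>" by (simp add: top_unique)
      then have "2 * (\<Sum>j\<in>UNIV. ?A j) / ennreal T * ennreal (C1 ?m + C2) = \<infinity>"
        unfolding \<open>(\<Sum>j\<in>UNIV. ?A j) = \<infinity>\<close>
        using T C by (simp add: ennreal_mult_eq_top_iff ennreal_top_divide ennreal_mult_top)
      then show ?thesis by simp
    qed
  next
    case False
    then obtain r where r: "?I = ennreal r" "r \<ge> 0" by (cases ?I) auto
    define A where "A j = enn2real (?A j)" for j
    have A: "?A j = ennreal (A j)" "A j \<ge> 0" for j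
      using False by (simp_all add: A_def less_top)
    have Ale: "partial_deriv j (joint_cdf N Y) y \<le> A j" for j y
    proof -
      have "ennreal (partial_deriv j (joint_cdf N Y) y) \<le> ?A j"
        unfolding A_coeff_def by (rule SUP_upper) simp
      then show ?thesis unfolding A using A(2) by (simp add: ennreal_le_iff)
    qed
    define d where "d J = enn2real (?S J)" for J
    have S1: "?S J \<le> 1" for J
    proof (rule SUP_least)
      fix z
      have "0 \<le> joint_cdf M (proj J X) z" "joint_cdf M (proj J X) z \<le> 1" "0 \<le> joint_cdf N (proj J Y) z" "joint_cdf N (proj J Y) z \<le> 1"
        using prob_space.prob_le_1[OF assms(1)] prob_space.prob_le_1[OF assms(3)] by (simp_all add: joint_cdf_def)
      then show "ennreal \<bar>joint_cdf M (proj J X) z - joint_cdf N (proj J Y) z\<bar> \<le> 1"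
        by (simp add: abs_le_iff)
    qed
    have d: "?S J = ennreal (d J)" "d J \<ge> 0" for J
    proof -
      have "?S J < top" using S1[of J] by (rule le_less_trans) simp
      then show "?S J = ennreal (d J)" "d J \<ge> 0" by (simp_all add: d_def)
    qed
    have dle: "\<bar>joint_cdf M (proj J X) (\<lambda>j\<in>J. z $ j) - joint_cdf N (proj J Y) (\<lambda>j\<in>J. z $ j)\<bar> \<le> d J" for J z
    proof -
      have "ennreal \<bar>joint_cdf M (proj J X) (\<lambda>j\<in>J. z $ j) - joint_cdf N (proj J Y) (\<lambda>j\<in>J. z $ j)\<bar> \<le> ?S J"
        by (rule SUP_upper) auto
      then show ?thesis unfolding d using d(2) by (simp add: ennreal_le_iff)
    qed
    let ?a = "2 / (2 * pi) ^ ?m * r"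
      and ?b = "\<Sum>J | J \<noteq> {} \<and> J \<subset> (UNIV :: 'n set). real (B_coeff (?m - card J)) * d J"
      and ?c = "2 * (\<Sum>j\<in>UNIV. A j) / T * (C1 ?m + C2)"
    have nn: "?a \<ge> 0" "?b \<ge> 0" "?c \<ge> 0" "(\<Sum>j\<in>UNIV. A j) \<ge> 0"
      using r(2) d(2) A(2) T C by (auto intro!: sum_nonneg mult_nonneg_nonneg divide_nonneg_pos)
    have "(SUP z. ennreal \<bar>joint_cdf M X z - joint_cdf N Y z\<bar>) \<le> ennreal (?a + 2 * ?b + ?c)"
      using berry_esseen_real[OF assms(1-4) T assms(5) A(2) Ale r dle] by (intro SUP_least ennreal_leI)
    also have "\<dots> = ennreal ?a + 2 * ennreal ?b + ennreal ?c"
      using nn by (simp add: ennreal_mult')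
    also have "ennreal ?a = ennreal (2 / (2 * pi) ^ ?m) * ?I"
      unfolding r(1) using r(2) by (intro ennreal_mult) auto
    also have "ennreal ?b = (\<Sum>J | J \<noteq> {} \<and> J \<subset> (UNIV :: 'n set). of_nat (B_coeff (?m - card J)) * ?S J)"
    proof -
      have "ennreal ?b = (\<Sum>J | J \<noteq> {} \<and> J \<subset> (UNIV :: 'n set). ennreal (real (B_coeff (?m - card J)) * d J))"
        using d(2) by (intro sum_ennreal[symmetric]) auto
      then show ?thesis using d(2) by (simp add: d(1) ennreal_mult ennreal_of_nat_eq_real_of_nat)
    qed
    also have "ennreal ?c = 2 * (\<Sum>j\<in>UNIV. ?A j) / ennreal T * ennreal (C1 ?m + C2)"
    proof -
      have "(\<Sum>j\<in>UNIV. ?A j) = ennreal (\<Sum>j\<in>UNIV. A j)"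
        using A by (simp add: sum_ennreal)
      then have "2 * (\<Sum>j\<in>UNIV. ?A j) / ennreal T = ennreal (2 * (\<Sum>j\<in>UNIV. A j) / T)"
        using nn(4) T by (simp add: divide_ennreal[symmetric] ennreal_mult)
      then show ?thesis
        using nn(4) T C by (subst ennreal_mult) auto
    qed
    finally show ?thesis .
  qed
qed

end
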